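(* Let $\mathsf{C}$ and $\mathsf{D}$ be strict monoidal categories. Then there is an isomorphism of categories $$\mathbf{Frob}(\mathsf{C},\mathsf{D})\cong\mathbf{Strict}(\mathsf{F}(\mathsf{C}),\mathsf{D}),$$ where $\mathsf{F}(\mathsf{C})$ is the strict monoidal category given by generators and relations described in the context.
   Context: Let $\mathsf{C}$ be a strict monoidal category with tensor product $\otimes$ and unit $\mathbb{1}$. **The Frobenius classifier $\mathsf{F}(\mathsf{C})$.** It is the strict monoidal category presented as follows. Its monoid of objects is the free monoid on the set of symbols $\{\underline{x}\mid x\in\mathrm{Obj}\,\mathsf{C}\}$, with tensor product given by concatenation and unit the empty list $\emptyset$. Its morphisms are generated, as a strict monoidal category (under composition and tensor product), by $\underline{f}:\underline{x}\to\underline{y}$ for all $x,y\in\mathrm{Obj}\,\mathsf{C}$ and $f\in\mathrm{Hom}_{\mathsf{C}}(x,y)$; $\ell_{x,z}:\underline{x}\otimes\underline{z}\to\underline{x\otimes z}$ and $k_{x,z}:\underline{x\otimes z}\to\underline{x}\otimes\underline{z}$ for all $x,z\in\mathrm{Obj}\,\mathsf{C}$; and $j:\emptyset\to\underline{\mathbb{1}}$, $q:\underline{\mathbb{1}}\to\emptyset$. The relations, for all objects and all suitable morphisms of $\mathsf{C}$, are: - $\underline{\mathrm{id}_x}=\mathrm{id}_{\underline{x}}$ and $\underline{g}\circ\underline{f}=\underline{g\circ f}$ for composable $f,g$; - $\ell_{y,y'}\circ(\underline{f}\otimes\underline{f'})=\underline{f\otimes f'}\circ\ell_{x,x'}$ and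 $(\underline{f}\otimes\underline{f'})\circ k_{x,x'}=k_{y,y'}\circ\underline{f\otimes f'}$ for $f:x\to y$, $f':x'\to y'$; - $\ell_{x\otimes z,w}\circ(\ell_{x,z}\otimes\mathrm{id}_{\underline{w}})=\ell_{x,z\otimes w}\circ(\mathrm{id}_{\underline{x}}\otimes\ell_{z,w})$ and $(k_{x,z}\otimes\mathrm{id}_{\underline{w}})\circ k_{x\otimes z,w}=(\mathrm{id}_{\underline{x}}\otimes k_{z,w})\circ k_{x,z\otimes w}$; - $\ell_{x,\mathbb{1}}\circ(\mathrm{id}_{\underline{x}}\otimes j)=\mathrm{id}_{\underline{x}}=\ell_{\mathbb{1},x}\circ(j\otimes\mathrm{id}_{\underline{x}})$ and $(\mathrm{id}_{\underline{x}}\otimes q)\circ k_{x,\mathbb{1}}=\mathrm{id}_{\underline{x}}=(q\otimes\mathrm{id}_{\underline{x}})\circ k_{\mathbb{1},x}$; - $k_{x\otimes z,w}\circ\ell_{x,z\otimes w}=(\ell_{x,z}\otimes\mathrm{id}_{\underline{w}})\circ(\mathrm{id}_{\underline{x}}\otimes k_{z,w})$; - $k_{x,z\otimes w}\circ\ell_{x\otimes z,w}=(\mathrm{id}_{\underline{x}}\otimes\ell_{z,w})\circ(k_{x,z}\otimes\mathrm{id}_{\underline{w}})$. **Frobenius monoidal functors.** Let $\mathcal{F}:\mathsf{C}\to\mathsf{D}$ be a functor between strict monoidal categories. A lax monoidal structure on $\mathcal{F}$ consists of morphisms $m_{X,Y}:\mathcal{F}(X)\otimes\mathcal{F}(Y)\to\mathcal{F}(X\otimes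 Y)$ natural in $X,Y$ and $u:\mathbb{1}_{\mathsf{D}}\to\mathcal{F}(\mathbb{1}_{\mathsf{C}})$ such that $m_{X\otimes Y,Z}\circ(m_{X,Y}\otimes\mathrm{id}_{\mathcal{F}(Z)})=m_{X,Y\otimes Z}\circ(\mathrm{id}_{\mathcal{F}(X)}\otimes m_{Y,Z})$, $m_{\mathbb{1},X}\circ(u\otimes\mathrm{id}_{\mathcal{F}(X)})=\mathrm{id}_{\mathcal{F}(X)}$ and $m_{X,\mathbb{1}}\circ(\mathrm{id}_{\mathcal{F}(X)}\otimes u)=\mathrm{id}_{\mathcal{F}(X)}$. An oplax monoidal structure on $\mathcal{F}$ consists of morphisms $c_{X,Y}:\mathcal{F}(X\otimes Y)\to\mathcal{F}(X)\otimes\mathcal{F}(Y)$ and $e:\mathcal{F}(\mathbb{1}_{\mathsf{C}})\to\mathbb{1}_{\mathsf{D}}$ making $\mathcal{F}^{\mathrm{op}}:\mathsf{C}^{\mathrm{op}}\to\mathsf{D}^{\mathrm{op}}$ lax monoidal (i.e. satisfying the same axioms with all arrows reversed). A Frobenius monoidal functor is a functor $\mathcal{F}$ with a lax monoidal structure $(m,u)$ and an oplax monoidal structure $(c,e)$ such that for all $X,Y,Z$: $$(m_{X,Y}\otimes\mathrm{id}_{\mathcal{F}(Z)})\circ(\mathrm{id}_{\mathcal{F}(X)}\otimes c_{Y,Z})=c_{X\otimes Y,Z}\circ m_{X,Y\otimes Z},$$ $$(\mathrm{id}_{\mathcal{F}(X)}\otimes m_{Y,Z})\circ(c_{X,Y}\otimes\mathrm{id}_{\mathcal{F}(Z)})=c_{X,Y\otimes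 Z}\circ m_{X\otimes Y,Z}.$$ **Functor categories.** $\mathbf{Frob}(\mathsf{C},\mathsf{D})$ has as objects the Frobenius monoidal functors $\mathsf{C}\to\mathsf{D}$ and as morphisms the natural transformations $\sigma:\mathcal{F}\Rightarrow\mathcal{G}$ that are simultaneously morphisms of lax and of oplax monoidal functors: $\sigma_{X\otimes Y}\circ m^{\mathcal{F}}_{X,Y}=m^{\mathcal{G}}_{X,Y}\circ(\sigma_X\otimes\sigma_Y)$, $\sigma_{\mathbb{1}}\circ u^{\mathcal{F}}=u^{\mathcal{G}}$, $c^{\mathcal{G}}_{X,Y}\circ\sigma_{X\otimes Y}=(\sigma_X\otimes\sigma_Y)\circ c^{\mathcal{F}}_{X,Y}$, $e^{\mathcal{G}}\circ\sigma_{\mathbb{1}}=e^{\mathcal{F}}$. $\mathbf{Strict}(\mathsf{C},\mathsf{D})$ has as objects the strict monoidal functors and as morphisms the monoidal transformations, i.e. natural transformations $\sigma$ with $\sigma_{X\otimes Y}=\sigma_X\otimes\sigma_Y$ and $\sigma_{\mathbb{1}}=\mathrm{id}$. *)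

theory Defs
  imports Main "HOL-Library.FuncSet"
begin

section \<open>Strict monoidal categories\<close>

text \<open>
  A category is given by a carrier set of objects and a carrier set of arrows, every arrow having
  one domain and one codomain. Composition is written in the classical order, and all operations
  are only constrained on the carriers.
\<close>

record ('o, 'a) cat_data =
  Obj :: "'o set"
  Arr :: "'a set"
  Dom :: "'a \<Rightarrow> 'o"
  Cod :: "'a \<Rightarrow> 'o"
  Iden :: "'o \<Rightarrow> 'a"
  Comp :: "'a \<Rightarrow> 'a \<Rightarrow> 'a"  (infixl "\<cdot>\<index>" 60)

definition Hom :: "('o, 'a, 'm) cat_data_scheme \<Rightarrow> 'o \<Rightarrow> 'o \<Rightarrow> 'a set" where
  "Hom C x y = {f \<in> Arr C. Dom C f = x \<and> Cod C f = y}"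

locale category =
  fixes C :: "('o, 'a, 'm) cat_data_scheme" (structure)
  assumes Dom_in: "f \<in> Arr C \<Longrightarrow> Dom C f \<in> Obj C"
    and Cod_in: "f \<in> Arr C \<Longrightarrow> Cod C f \<in> Obj C"
    and Id_in: "x \<in> Obj C \<Longrightarrow> Iden C x \<in> Hom C x x"
    and Comp_in: "f \<in> Hom C x y \<Longrightarrow> g \<in> Hom C y z \<Longrightarrow> g \<cdot> f \<in> Hom C x z"
    and Comp_Id_left: "f \<in> Hom C x y \<Longrightarrow> Iden C y \<cdot> f = f"
    and Comp_Id_right: "f \<in> Hom C x y \<Longrightarrow> f \<cdot> Iden C x = f"
    and Comp_assoc: "f \<in> Hom C x y \<Longrightarrow> g \<in> Hom C y z \<Longrightarrow> h \<in> Hom C z w \<Longrightarrow>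
      (h \<cdot> g) \<cdot> f = h \<cdot> (g \<cdot> f)"

text \<open>The tensor product is \<open>\<odot>\<close> on objects and \<open>\<otimes>\<close> on arrows.\<close>

record ('o, 'a) smc_data = "('o, 'a) cat_data" +
  TensorO :: "'o \<Rightarrow> 'o \<Rightarrow> 'o"  (infixl "\<odot>\<index>" 70)
  Tensor :: "'a \<Rightarrow> 'a \<Rightarrow> 'a"  (infixl "\<otimes>\<index>" 70)
  Unit :: "'o"  ("\<one>\<index>")

locale strict_monoidal_category = category C
  for C :: "('o, 'a, 'm) smc_data_scheme" (structure) +
  assumes Unit_in: "\<one> \<in> Obj C"
    and TensorO_in: "x \<in> Obj C \<Longrightarrow> y \<in> Obj C \<Longrightarrow> x \<odot> y \<in> Obj C"
    and TensorO_assoc: "x \<in> Obj C \<Longrightarrow> y \<in> Obj C \<Longrightarrow> z \<in> Obj C \<Longrightarrow> (x \<odot> y) \<odot> z = x \<odot> (y \<odot> z)"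
    and TensorO_Unit_left: "x \<in> Obj C \<Longrightarrow> \<one> \<odot> x = x"
    and TensorO_Unit_right: "x \<in> Obj C \<Longrightarrow> x \<odot> \<one> = x"
    and Tensor_in: "f \<in> Hom C x y \<Longrightarrow> f' \<in> Hom C x' y' \<Longrightarrow> f \<otimes> f' \<in> Hom C (x \<odot> x') (y \<odot> y')"
    and Tensor_Id: "x \<in> Obj C \<Longrightarrow> y \<in> Obj C \<Longrightarrow> Iden C x \<otimes> Iden C y = Iden C (x \<odot> y)"
    and interchange:
      "f \<in> Hom C x y \<Longrightarrow> g \<in> Hom C y z \<Longrightarrow> f' \<in> Hom C x' y' \<Longrightarrow> g' \<in> Hom C y' z' \<Longrightarrow>
        (g \<cdot> f) \<otimes> (g' \<cdot> f') = (g \<otimes> g') \<cdot> (f \<otimes> f')"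
    and Tensor_assoc: "f \<in> Arr C \<Longrightarrow> g \<in> Arr C \<Longrightarrow> h \<in> Arr C \<Longrightarrow> (f \<otimes> g) \<otimes> h = f \<otimes> (g \<otimes> h)"
    and Tensor_Unit_left: "f \<in> Arr C \<Longrightarrow> Iden C \<one> \<otimes> f = f"
    and Tensor_Unit_right: "f \<in> Arr C \<Longrightarrow> f \<otimes> Iden C \<one> = f"


section \<open>Functors, transformations and isomorphism of categories\<close>

text \<open>
  Functors and transformations are total HOL functions. Requiring them to be extensional
  (\<open>undefined\<close> outside the carriers) makes HOL equality of such data coincide with mathematical
  equality, so that they can serve as the objects and arrows of functor categories.
\<close>

record ('o, 'a, 'p, 'b) functor_data =
  FObj :: "'o \<Rightarrow> 'p"
  FArr :: "'a \<Rightarrow> 'b"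

locale cat_functor = C: category C + D: category D
  for C :: "('o, 'a, 'm) cat_data_scheme"
    and D :: "('p, 'b, 'n) cat_data_scheme"
    and F :: "('o, 'a, 'p, 'b, 'r) functor_data_scheme" +
  assumes FObj_in: "FObj F \<in> Obj C \<rightarrow>\<^sub>E Obj D"
    and FArr_ext: "FArr F \<in> extensional (Arr C)"
    and FArr_in: "f \<in> Hom C x y \<Longrightarrow> FArr F f \<in> Hom D (FObj F x) (FObj F y)"
    and FArr_Id: "x \<in> Obj C \<Longrightarrow> FArr F (Iden C x) = Iden D (FObj F x)"
    and FArr_Comp: "f \<in> Hom C x y \<Longrightarrow> g \<in> Hom C y z \<Longrightarrow>
      FArr F (g \<cdot>\<^bsub>C\<^esub> f) = FArr F g \<cdot>\<^bsub>D\<^esub> FArr F f"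

definition nat_transformation ::
  "('o, 'a, 'm) cat_data_scheme \<Rightarrow> ('p, 'b, 'n) cat_data_scheme \<Rightarrow>
   ('o, 'a, 'p, 'b, 'r) functor_data_scheme \<Rightarrow> ('o, 'a, 'p, 'b, 's) functor_data_scheme \<Rightarrow>
   ('o \<Rightarrow> 'b) \<Rightarrow> bool" where
  "nat_transformation C D F G \<sigma> \<longleftrightarrow>
    \<sigma> \<in> extensional (Obj C) \<and>
    (\<forall>x\<in>Obj C. \<sigma> x \<in> Hom D (FObj F x) (FObj G x)) \<and>
    (\<forall>x\<in>Obj C. \<forall>y\<in>Obj C. \<forall>f\<in>Hom C x y. \<sigma> y \<cdot>\<^bsub>D\<^esub> FArr F f = FArr G f \<cdot>\<^bsub>D\<^esub> \<sigma> x)"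

definition isomorphic_categories ::
  "('o, 'a, 'm) cat_data_scheme \<Rightarrow> ('p, 'b, 'n) cat_data_scheme \<Rightarrow> bool" where
  "isomorphic_categories A B \<longleftrightarrow>
    (\<exists>(\<Phi> :: ('o, 'a, 'p, 'b) functor_data) (\<Psi> :: ('p, 'b, 'o, 'a) functor_data).
      cat_functor A B \<Phi> \<and> cat_functor B A \<Psi> \<and>
      (\<forall>X\<in>Obj A. FObj \<Psi> (FObj \<Phi> X) = X) \<and> (\<forall>f\<in>Arr A. FArr \<Psi> (FArr \<Phi> f) = f) \<and>
      (\<forall>Y\<in>Obj B. FObj \<Phi> (FObj \<Psi> Y) = Y) \<and> (\<forall>g\<in>Arr B. FArr \<Phi> (FArr \<Psi> g) = g))"

text \<open>
  The category with the objects \<open>F\<close> satisfying \<open>P\<close>, whose arrows are the triples \<open>(F, G, \<sigma>)\<close>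
  with \<open>T F G \<sigma>\<close>, under vertical composition.
\<close>

definition transformation_category ::
  "('o, 'a, 'm) cat_data_scheme \<Rightarrow> ('p, 'b, 'n) cat_data_scheme \<Rightarrow>
   (('o, 'a, 'p, 'b, 'r) functor_data_scheme \<Rightarrow> bool) \<Rightarrow>
   (('o, 'a, 'p, 'b, 'r) functor_data_scheme \<Rightarrow> ('o, 'a, 'p, 'b, 'r) functor_data_scheme \<Rightarrow>
     ('o \<Rightarrow> 'b) \<Rightarrow> bool) \<Rightarrow>
   (('o, 'a, 'p, 'b, 'r) functor_data_scheme,
    ('o, 'a, 'p, 'b, 'r) functor_data_scheme \<times> ('o, 'a, 'p, 'b, 'r) functor_data_scheme \<times>
      ('o \<Rightarrow> 'b)) cat_data" where
  "transformation_category C D P T =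
    \<lparr> Obj = {F. P F},
      Arr = {(F, G, \<sigma>). P F \<and> P G \<and> T F G \<sigma>},
      Dom = (\<lambda>(F, G, \<sigma>). F),
      Cod = (\<lambda>(F, G, \<sigma>). G),
      Iden = (\<lambda>F. (F, F, \<lambda>x\<in>Obj C. Iden D (FObj F x))),
      Comp = (\<lambda>(G', H, \<tau>) (F, G, \<sigma>). (F, H, \<lambda>x\<in>Obj C. \<tau> x \<cdot>\<^bsub>D\<^esub> \<sigma> x)) \<rparr>"


section \<open>Strict monoidal functors\<close>

locale strict_monoidal_functor =
  C: strict_monoidal_category C + D: strict_monoidal_category D + cat_functor C D F
  for C :: "('o, 'a, 'm) smc_data_scheme"
    and D :: "('p, 'b, 'n) smc_data_scheme"
    and F :: "('o, 'a, 'p, 'b, 'r) functor_data_scheme" +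
  assumes FObj_Unit: "FObj F \<one>\<^bsub>C\<^esub> = \<one>\<^bsub>D\<^esub>"
    and FObj_TensorO: "x \<in> Obj C \<Longrightarrow> y \<in> Obj C \<Longrightarrow>
      FObj F (x \<odot>\<^bsub>C\<^esub> y) = FObj F x \<odot>\<^bsub>D\<^esub> FObj F y"
    and FArr_Tensor: "f \<in> Arr C \<Longrightarrow> g \<in> Arr C \<Longrightarrow>
      FArr F (f \<otimes>\<^bsub>C\<^esub> g) = FArr F f \<otimes>\<^bsub>D\<^esub> FArr F g"

definition monoidal_transformation ::
  "('o, 'a, 'm) smc_data_scheme \<Rightarrow> ('p, 'b, 'n) smc_data_scheme \<Rightarrow>
   ('o, 'a, 'p, 'b) functor_data \<Rightarrow> ('o, 'a, 'p, 'b) functor_data \<Rightarrow> ('o \<Rightarrow> 'b) \<Rightarrow> bool" where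
  "monoidal_transformation C D F G \<sigma> \<longleftrightarrow>
    nat_transformation C D F G \<sigma> \<and>
    (\<forall>x\<in>Obj C. \<forall>y\<in>Obj C. \<sigma> (x \<odot>\<^bsub>C\<^esub> y) = \<sigma> x \<otimes>\<^bsub>D\<^esub> \<sigma> y) \<and>
    \<sigma> \<one>\<^bsub>C\<^esub> = Iden D \<one>\<^bsub>D\<^esub>"

definition Strict ::
  "('o, 'a, 'm) smc_data_scheme \<Rightarrow> ('p, 'b, 'n) smc_data_scheme \<Rightarrow>
   (('o, 'a, 'p, 'b) functor_data,
    ('o, 'a, 'p, 'b) functor_data \<times> ('o, 'a, 'p, 'b) functor_data \<times> ('o \<Rightarrow> 'b)) cat_data" where
  "Strict C D =
    transformation_category C D (strict_monoidal_functor C D) (monoidal_transformation C D)"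


section \<open>Frobenius monoidal functors\<close>

record ('o, 'a, 'p, 'b) frob_functor_data = "('o, 'a, 'p, 'b) functor_data" +
  lax_mult :: "'o \<times> 'o \<Rightarrow> 'b"
  lax_unit :: "'b"
  oplax_comult :: "'o \<times> 'o \<Rightarrow> 'b"
  oplax_counit :: "'b"

definition lax_structure ::
  "('o, 'a, 'm) smc_data_scheme \<Rightarrow> ('p, 'b, 'n) smc_data_scheme \<Rightarrow>
   ('o, 'a, 'p, 'b, 'r) functor_data_scheme \<Rightarrow> ('o \<times> 'o \<Rightarrow> 'b) \<Rightarrow> 'b \<Rightarrow> bool" where
  "lax_structure C D F m u \<longleftrightarrow>
    m \<in> extensional (Obj C \<times> Obj C) \<and>
    (\<forall>x\<in>Obj C. \<forall>y\<in>Obj C. m (x, y) \<in> Hom D (FObj F x \<odot>\<^bsub>D\<^esub> FObj F y) (FObj F (x \<odot>\<^bsub>C\<^esub> y))) \<and>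
    u \<in> Hom D \<one>\<^bsub>D\<^esub> (FObj F \<one>\<^bsub>C\<^esub>) \<and>
    (\<forall>x\<in>Obj C. \<forall>x'\<in>Obj C. \<forall>y\<in>Obj C. \<forall>y'\<in>Obj C. \<forall>f\<in>Hom C x y. \<forall>f'\<in>Hom C x' y'.
      m (y, y') \<cdot>\<^bsub>D\<^esub> (FArr F f \<otimes>\<^bsub>D\<^esub> FArr F f') = FArr F (f \<otimes>\<^bsub>C\<^esub> f') \<cdot>\<^bsub>D\<^esub> m (x, x')) \<and>
    (\<forall>x\<in>Obj C. \<forall>y\<in>Obj C. \<forall>z\<in>Obj C.
      m (x \<odot>\<^bsub>C\<^esub> y, z) \<cdot>\<^bsub>D\<^esub> (m (x, y) \<otimes>\<^bsub>D\<^esub> Iden D (FObj F z)) =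
      m (x, y \<odot>\<^bsub>C\<^esub> z) \<cdot>\<^bsub>D\<^esub> (Iden D (FObj F x) \<otimes>\<^bsub>D\<^esub> m (y, z))) \<and>
    (\<forall>x\<in>Obj C. m (\<one>\<^bsub>C\<^esub>, x) \<cdot>\<^bsub>D\<^esub> (u \<otimes>\<^bsub>D\<^esub> Iden D (FObj F x)) = Iden D (FObj F x)) \<and>
    (\<forall>x\<in>Obj C. m (x, \<one>\<^bsub>C\<^esub>) \<cdot>\<^bsub>D\<^esub> (Iden D (FObj F x) \<otimes>\<^bsub>D\<^esub> u) = Iden D (FObj F x))"

definition oplax_structure ::
  "('o, 'a, 'm) smc_data_scheme \<Rightarrow> ('p, 'b, 'n) smc_data_scheme \<Rightarrow>
   ('o, 'a, 'p, 'b, 'r) functor_data_scheme \<Rightarrow> ('o \<times> 'o \<Rightarrow> 'b) \<Rightarrow> 'b \<Rightarrow> bool" where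
  "oplax_structure C D F c e \<longleftrightarrow>
    c \<in> extensional (Obj C \<times> Obj C) \<and>
    (\<forall>x\<in>Obj C. \<forall>y\<in>Obj C. c (x, y) \<in> Hom D (FObj F (x \<odot>\<^bsub>C\<^esub> y)) (FObj F x \<odot>\<^bsub>D\<^esub> FObj F y)) \<and>
    e \<in> Hom D (FObj F \<one>\<^bsub>C\<^esub>) \<one>\<^bsub>D\<^esub> \<and>
    (\<forall>x\<in>Obj C. \<forall>x'\<in>Obj C. \<forall>y\<in>Obj C. \<forall>y'\<in>Obj C. \<forall>f\<in>Hom C x y. \<forall>f'\<in>Hom C x' y'.
      (FArr F f \<otimes>\<^bsub>D\<^esub> FArr F f') \<cdot>\<^bsub>D\<^esub> c (x, x') = c (y, y') \<cdot>\<^bsub>D\<^esub> FArr F (f \<otimes>\<^bsub>C\<^esub> f')) \<and>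
    (\<forall>x\<in>Obj C. \<forall>y\<in>Obj C. \<forall>z\<in>Obj C.
      (c (x, y) \<otimes>\<^bsub>D\<^esub> Iden D (FObj F z)) \<cdot>\<^bsub>D\<^esub> c (x \<odot>\<^bsub>C\<^esub> y, z) =
      (Iden D (FObj F x) \<otimes>\<^bsub>D\<^esub> c (y, z)) \<cdot>\<^bsub>D\<^esub> c (x, y \<odot>\<^bsub>C\<^esub> z)) \<and>
    (\<forall>x\<in>Obj C. (e \<otimes>\<^bsub>D\<^esub> Iden D (FObj F x)) \<cdot>\<^bsub>D\<^esub> c (\<one>\<^bsub>C\<^esub>, x) = Iden D (FObj F x)) \<and>
    (\<forall>x\<in>Obj C. (Iden D (FObj F x) \<otimes>\<^bsub>D\<^esub> e) \<cdot>\<^bsub>D\<^esub> c (x, \<one>\<^bsub>C\<^esub>) = Iden D (FObj F x))"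

locale frobenius_functor =
  C: strict_monoidal_category C + D: strict_monoidal_category D + cat_functor C D F
  for C :: "('o, 'a, 'm) smc_data_scheme"
    and D :: "('p, 'b, 'n) smc_data_scheme"
    and F :: "('o, 'a, 'p, 'b) frob_functor_data" +
  assumes lax: "lax_structure C D F (lax_mult F) (lax_unit F)"
    and oplax: "oplax_structure C D F (oplax_comult F) (oplax_counit F)"
    and Frobenius_left: "x \<in> Obj C \<Longrightarrow> y \<in> Obj C \<Longrightarrow> z \<in> Obj C \<Longrightarrow>
      (lax_mult F (x, y) \<otimes>\<^bsub>D\<^esub> Iden D (FObj F z)) \<cdot>\<^bsub>D\<^esub> (Iden D (FObj F x) \<otimes>\<^bsub>D\<^esub> oplax_comult F (y, z)) =
      oplax_comult F (x \<odot>\<^bsub>C\<^esub> y, z) \<cdot>\<^bsub>D\<^esub> lax_mult F (x, y \<odot>\<^bsub>C\<^esub> z)"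
    and Frobenius_right: "x \<in> Obj C \<Longrightarrow> y \<in> Obj C \<Longrightarrow> z \<in> Obj C \<Longrightarrow>
      (Iden D (FObj F x) \<otimes>\<^bsub>D\<^esub> lax_mult F (y, z)) \<cdot>\<^bsub>D\<^esub> (oplax_comult F (x, y) \<otimes>\<^bsub>D\<^esub> Iden D (FObj F z)) =
      oplax_comult F (x, y \<odot>\<^bsub>C\<^esub> z) \<cdot>\<^bsub>D\<^esub> lax_mult F (x \<odot>\<^bsub>C\<^esub> y, z)"

definition frobenius_transformation ::
  "('o, 'a, 'm) smc_data_scheme \<Rightarrow> ('p, 'b, 'n) smc_data_scheme \<Rightarrow>
   ('o, 'a, 'p, 'b) frob_functor_data \<Rightarrow> ('o, 'a, 'p, 'b) frob_functor_data \<Rightarrow>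
   ('o \<Rightarrow> 'b) \<Rightarrow> bool" where
  "frobenius_transformation C D F G \<sigma> \<longleftrightarrow>
    nat_transformation C D F G \<sigma> \<and>
    (\<forall>x\<in>Obj C. \<forall>y\<in>Obj C.
      \<sigma> (x \<odot>\<^bsub>C\<^esub> y) \<cdot>\<^bsub>D\<^esub> lax_mult F (x, y) = lax_mult G (x, y) \<cdot>\<^bsub>D\<^esub> (\<sigma> x \<otimes>\<^bsub>D\<^esub> \<sigma> y)) \<and>
    \<sigma> \<one>\<^bsub>C\<^esub> \<cdot>\<^bsub>D\<^esub> lax_unit F = lax_unit G \<and>
    (\<forall>x\<in>Obj C. \<forall>y\<in>Obj C.
      oplax_comult G (x, y) \<cdot>\<^bsub>D\<^esub> \<sigma> (x \<odot>\<^bsub>C\<^esub> y) = (\<sigma> x \<otimes>\<^bsub>D\<^esub> \<sigma> y) \<cdot>\<^bsub>D\<^esub> oplax_comult F (x, y)) \<and>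
    oplax_counit G \<cdot>\<^bsub>D\<^esub> \<sigma> \<one>\<^bsub>C\<^esub> = oplax_counit F"

definition Frob ::
  "('o, 'a, 'm) smc_data_scheme \<Rightarrow> ('p, 'b, 'n) smc_data_scheme \<Rightarrow>
   (('o, 'a, 'p, 'b) frob_functor_data,
    ('o, 'a, 'p, 'b) frob_functor_data \<times> ('o, 'a, 'p, 'b) frob_functor_data \<times> ('o \<Rightarrow> 'b)) cat_data"
  where
  "Frob C D =
    transformation_category C D (frobenius_functor C D) (frobenius_transformation C D)"


section \<open>The Frobenius classifier\<close>

text \<open>
  Objects are lists over \<open>Obj C\<close>, the list \<open>[x]\<close> being the symbol attached to \<open>x\<close>. Arrows are
  classes of well-formed formal composites and tensor products of the generators modulo \<open>feq\<close>,
  the least congruence containing the strict monoidal category axioms and the given relations.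
\<close>

datatype ('o, 'a) fterm =
    FId "'o list"
  | FGen 'a
  | FL 'o 'o
  | FK 'o 'o
  | FJ
  | FQ
  | FComp "('o, 'a) fterm" "('o, 'a) fterm"  (infixl "\<bullet>" 60)
  | FTen "('o, 'a) fterm" "('o, 'a) fterm"  (infixl "\<diamondop>" 70)

primrec fdom :: "('o, 'a, 'm) smc_data_scheme \<Rightarrow> ('o, 'a) fterm \<Rightarrow> 'o list" where
  "fdom C (FId X) = X"
| "fdom C (FGen f) = [Dom C f]"
| "fdom C (FL x z) = [x, z]"
| "fdom C (FK x z) = [x \<odot>\<^bsub>C\<^esub> z]"
| "fdom C FJ = []"
| "fdom C FQ = [\<one>\<^bsub>C\<^esub>]"
| "fdom C (t \<bullet> s) = fdom C s"
| "fdom C (t \<diamondop> s) = fdom C t @ fdom C s"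

primrec fcod :: "('o, 'a, 'm) smc_data_scheme \<Rightarrow> ('o, 'a) fterm \<Rightarrow> 'o list" where
  "fcod C (FId X) = X"
| "fcod C (FGen f) = [Cod C f]"
| "fcod C (FL x z) = [x \<odot>\<^bsub>C\<^esub> z]"
| "fcod C (FK x z) = [x, z]"
| "fcod C FJ = [\<one>\<^bsub>C\<^esub>]"
| "fcod C FQ = []"
| "fcod C (t \<bullet> s) = fcod C t"
| "fcod C (t \<diamondop> s) = fcod C t @ fcod C s"

primrec fwf :: "('o, 'a, 'm) smc_data_scheme \<Rightarrow> ('o, 'a) fterm \<Rightarrow> bool" where
  "fwf C (FId X) \<longleftrightarrow> X \<in> lists (Obj C)"
| "fwf C (FGen f) \<longleftrightarrow> f \<in> Arr C"
| "fwf C (FL x z) \<longleftrightarrow> x \<in> Obj C \<and> z \<in> Obj C"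
| "fwf C (FK x z) \<longleftrightarrow> x \<in> Obj C \<and> z \<in> Obj C"
| "fwf C FJ \<longleftrightarrow> True"
| "fwf C FQ \<longleftrightarrow> True"
| "fwf C (t \<bullet> s) \<longleftrightarrow> fwf C t \<and> fwf C s \<and> fdom C t = fcod C s"
| "fwf C (t \<diamondop> s) \<longleftrightarrow> fwf C t \<and> fwf C s"

inductive feq :: "('o, 'a, 'm) smc_data_scheme \<Rightarrow> ('o, 'a) fterm \<Rightarrow> ('o, 'a) fterm \<Rightarrow> bool"
  for C :: "('o, 'a, 'm) smc_data_scheme" (structure) where
  feq_refl: "fwf C t \<Longrightarrow> feq C t t"
| feq_sym: "feq C t s \<Longrightarrow> feq C s t"
| feq_trans: "feq C t s \<Longrightarrow> feq C s r \<Longrightarrow> feq C t r"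
| feq_cong_comp: "feq C t t' \<Longrightarrow> feq C s s' \<Longrightarrow> fdom C t = fcod C s \<Longrightarrow> feq C (t \<bullet> s) (t' \<bullet> s')"
| feq_cong_ten: "feq C t t' \<Longrightarrow> feq C s s' \<Longrightarrow> feq C (t \<diamondop> s) (t' \<diamondop> s')"
\<comment> \<open>axioms of a strict monoidal category\<close>
| feq_comp_id_left: "fwf C t \<Longrightarrow> feq C (FId (fcod C t) \<bullet> t) t"
| feq_comp_id_right: "fwf C t \<Longrightarrow> feq C (t \<bullet> FId (fdom C t)) t"
| feq_comp_assoc: "fwf C (r \<bullet> t \<bullet> s) \<Longrightarrow> feq C (r \<bullet> t \<bullet> s) (r \<bullet> (t \<bullet> s))"
| feq_ten_id: "X \<in> lists (Obj C) \<Longrightarrow> Y \<in> lists (Obj C) \<Longrightarrow> feq C (FId X \<diamondop> FId Y) (FId (X @ Y))"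
| feq_ten_comp: "fwf C (t \<bullet> s) \<Longrightarrow> fwf C (t' \<bullet> s') \<Longrightarrow>
    feq C ((t \<bullet> s) \<diamondop> (t' \<bullet> s')) ((t \<diamondop> t') \<bullet> (s \<diamondop> s'))"
| feq_ten_assoc: "fwf C t \<Longrightarrow> fwf C s \<Longrightarrow> fwf C r \<Longrightarrow> feq C ((t \<diamondop> s) \<diamondop> r) (t \<diamondop> (s \<diamondop> r))"
| feq_ten_unit_left: "fwf C t \<Longrightarrow> feq C (FId [] \<diamondop> t) t"
| feq_ten_unit_right: "fwf C t \<Longrightarrow> feq C (t \<diamondop> FId []) t"
\<comment> \<open>defining relations\<close>
| feq_gen_id: "x \<in> Obj C \<Longrightarrow> feq C (FGen (Iden C x)) (FId [x])"
| feq_gen_comp: "f \<in> Hom C x y \<Longrightarrow> g \<in> Hom C y z \<Longrightarrow> feq C (FGen g \<bullet> FGen f) (FGen (g \<cdot> f))"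
| feq_l_nat: "f \<in> Hom C x y \<Longrightarrow> f' \<in> Hom C x' y' \<Longrightarrow>
    feq C (FL y y' \<bullet> (FGen f \<diamondop> FGen f')) (FGen (f \<otimes> f') \<bullet> FL x x')"
| feq_k_nat: "f \<in> Hom C x y \<Longrightarrow> f' \<in> Hom C x' y' \<Longrightarrow>
    feq C ((FGen f \<diamondop> FGen f') \<bullet> FK x x') (FK y y' \<bullet> FGen (f \<otimes> f'))"
| feq_l_assoc: "x \<in> Obj C \<Longrightarrow> z \<in> Obj C \<Longrightarrow> w \<in> Obj C \<Longrightarrow>
    feq C (FL (x \<odot> z) w \<bullet> (FL x z \<diamondop> FId [w])) (FL x (z \<odot> w) \<bullet> (FId [x] \<diamondop> FL z w))"
| feq_k_assoc: "x \<in> Obj C \<Longrightarrow> z \<in> Obj C \<Longrightarrow> w \<in> Obj C \<Longrightarrow>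
    feq C ((FK x z \<diamondop> FId [w]) \<bullet> FK (x \<odot> z) w) ((FId [x] \<diamondop> FK z w) \<bullet> FK x (z \<odot> w))"
| feq_l_unit_right: "x \<in> Obj C \<Longrightarrow> feq C (FL x \<one> \<bullet> (FId [x] \<diamondop> FJ)) (FId [x])"
| feq_l_unit_left: "x \<in> Obj C \<Longrightarrow> feq C (FL \<one> x \<bullet> (FJ \<diamondop> FId [x])) (FId [x])"
| feq_k_unit_right: "x \<in> Obj C \<Longrightarrow> feq C ((FId [x] \<diamondop> FQ) \<bullet> FK x \<one>) (FId [x])"
| feq_k_unit_left: "x \<in> Obj C \<Longrightarrow> feq C ((FQ \<diamondop> FId [x]) \<bullet> FK \<one> x) (FId [x])"
| feq_frob_left: "x \<in> Obj C \<Longrightarrow> z \<in> Obj C \<Longrightarrow> w \<in> Obj C \<Longrightarrow>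
    feq C (FK (x \<odot> z) w \<bullet> FL x (z \<odot> w)) ((FL x z \<diamondop> FId [w]) \<bullet> (FId [x] \<diamondop> FK z w))"
| feq_frob_right: "x \<in> Obj C \<Longrightarrow> z \<in> Obj C \<Longrightarrow> w \<in> Obj C \<Longrightarrow>
    feq C (FK x (z \<odot> w) \<bullet> FL (x \<odot> z) w) ((FId [x] \<diamondop> FL z w) \<bullet> (FK x z \<diamondop> FId [w]))"

definition fclass :: "('o, 'a, 'm) smc_data_scheme \<Rightarrow> ('o, 'a) fterm \<Rightarrow> ('o, 'a) fterm set" where
  "fclass C t = {s. feq C t s}"

definition frep :: "('o, 'a) fterm set \<Rightarrow> ('o, 'a) fterm" where
  "frep A = (SOME t. t \<in> A)"

definition Frobenius_classifier ::
  "('o, 'a, 'm) smc_data_scheme \<Rightarrow> ('o list, ('o, 'a) fterm set) smc_data" where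
  "Frobenius_classifier C =
    \<lparr> Obj = lists (Obj C),
      Arr = fclass C ` {t. fwf C t},
      Dom = (\<lambda>A. fdom C (frep A)),
      Cod = (\<lambda>A. fcod C (frep A)),
      Iden = (\<lambda>X. fclass C (FId X)),
      Comp = (\<lambda>A B. fclass C (frep A \<bullet> frep B)),
      TensorO = (@),
      Tensor = (\<lambda>A B. fclass C (frep A \<diamondop> frep B)),
      Unit = [] \<rparr>"

context strict_monoidal_category
begin

lemma feq_parallel:
  assumes "feq C t s"
  shows "fwf C t \<and> fwf C s \<and> fdom C t = fdom C s \<and> fcod C t = fcod C s"
  using assms
proof (induction rule: feq.induct)
  case (feq_gen_comp f x y g z)
  then show ?case using Comp_in[of f x y g z] by (auto simp: Hom_def)
next
  case (feq_l_nat f x y f' x' y')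
  then show ?case using Tensor_in[of f x y f' x' y'] Dom_in Cod_in by (auto simp: Hom_def)
next
  case (feq_k_nat f x y f' x' y')
  then show ?case using Tensor_in[of f x y f' x' y'] Dom_in Cod_in by (auto simp: Hom_def)
next
  case (feq_gen_id x)
  then show ?case using Id_in[of x] by (auto simp: Hom_def)
next
  case (feq_comp_id_left t)
  then show ?case
    by (induction t) (auto simp: Dom_in Cod_in TensorO_in Unit_in)
next
  case (feq_comp_id_right t)
  then show ?case
    by (induction t) (auto simp: Dom_in Cod_in TensorO_in Unit_in)
qed (auto simp: TensorO_in Unit_in TensorO_assoc TensorO_Unit_left TensorO_Unit_right)

lemma fdom_fcod_in:
  "fwf C t \<Longrightarrow> fdom C t \<in> lists (Obj C)" "fwf C t \<Longrightarrow> fcod C t \<in> lists (Obj C)"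
  by (induction t) (auto simp: Dom_in Cod_in TensorO_in Unit_in)

lemma fclass_eq: "feq C t s \<Longrightarrow> fclass C t = fclass C s"
  unfolding fclass_def by (blast intro: feq_sym feq_trans)

lemma fclass_eq_iff: "fwf C t \<Longrightarrow> fclass C t = fclass C s \<longleftrightarrow> feq C t s"
  unfolding fclass_def by (blast intro: feq_refl feq_sym feq_trans)

lemma frep: "fwf C t \<Longrightarrow> feq C t (frep (fclass C t))"
  unfolding frep_def fclass_def by (rule someI2[of _ t]) (auto intro: feq_refl)

abbreviation (input) "FC \<equiv> Frobenius_classifier C"

lemma FC_simps:
  "Obj FC = lists (Obj C)"
  "Arr FC = fclass C ` {t. fwf C t}"
  "Iden FC X = fclass C (FId X)"
  "TensorO FC X Y = X @ Y"
  "Unit FC = []"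
  by (simp_all add: Frobenius_classifier_def)

lemma FC_Dom: "fwf C t \<Longrightarrow> Dom FC (fclass C t) = fdom C t"
  using feq_parallel[OF frep] by (simp add: Frobenius_classifier_def)

lemma FC_Cod: "fwf C t \<Longrightarrow> Cod FC (fclass C t) = fcod C t"
  using feq_parallel[OF frep] by (simp add: Frobenius_classifier_def)

lemma FC_Comp: "fwf C (t \<bullet> s) \<Longrightarrow> Comp FC (fclass C t) (fclass C s) = fclass C (t \<bullet> s)"
  by (auto simp: Frobenius_classifier_def intro!: fclass_eq[symmetric] feq_cong_comp frep)

lemma FC_Tensor: "fwf C t \<Longrightarrow> fwf C s \<Longrightarrow> Tensor FC (fclass C t) (fclass C s) = fclass C (t \<diamondop> s)"
  by (auto simp: Frobenius_classifier_def intro!: fclass_eq[symmetric] feq_cong_ten frep)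

lemma FC_Hom: "Hom FC X Y = fclass C ` {t. fwf C t \<and> fdom C t = X \<and> fcod C t = Y}"
  by (auto simp: Hom_def FC_simps FC_Dom FC_Cod)

lemma strict_monoidal_category_Frobenius_classifier:
  "strict_monoidal_category (Frobenius_classifier C)"
proof -
  note eqs = feq_comp_id_left feq_comp_id_right feq_comp_assoc feq_ten_id feq_ten_comp feq_ten_assoc
    feq_ten_unit_left feq_ten_unit_right
  show ?thesis
    by unfold_locales
      (use fdom_fcod_in in \<open>fastforce simp: FC_Hom FC_simps FC_Dom FC_Cod FC_Comp FC_Tensor
        eqs[THEN fclass_eq]\<close>)+
qed

end

end

theory Submission
  imports Defs
begin

text \<open>
  A Frobenius monoidal functor is exactly an assignment of objects and arrows of \<open>D\<close> to the
  generators of the classifier satisfying its relations, so it extends to a unique strict monoidal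
  functor by evaluating formal terms; restriction to the generators is the inverse. Likewise the
  components of a monoidal transformation are determined by those at one-element lists, and its
  naturality with respect to the generators is exactly the definition of a Frobenius transformation.
\<close>

section \<open>Functor categories and isomorphisms\<close>

text \<open>An isomorphism, not merely an equivalence, is possible because nothing is left to
  choose: objects of the classifier are free on letters and all functors out of it are strict, so
  the value on a list is forced to be an iterated tensor product. For the round trips to be
  equalities of HOL functions all data must be extensional; hence each construction is cut down to
  the carriers, and each inverse law also treats arguments outside them. The operations of the
  classifier act on classes through a chosen representative. Evaluation is therefore defined on raw
  terms, and invariance under \<open>feq\<close> removes the choice once; what follows can argue by
  induction on terms. The defining relations enter through functors only. For transformations term
  induction suffices, since the arrows at which a monoidal family is natural are closed under
  composition and tensor product.\<close>

lemma (in category) Iden_simps [simp]: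
  assumes "x \<in> Obj C"
  shows "Iden C x \<in> Arr C" "Dom C (Iden C x) = x" "Cod C (Iden C x) = x"
  using Id_in[OF assms] by (auto simp: Hom_def)

lemma (in category) HomD:
  assumes "f \<in> Hom C x y"
  shows "f \<in> Arr C" "x \<in> Obj C" "y \<in> Obj C" "Dom C f = x" "Cod C f = y"
  using assms Dom_in Cod_in by (auto simp: Hom_def)

lemma (in category) Arr_Hom: "f \<in> Arr C \<Longrightarrow> f \<in> Hom C (Dom C f) (Cod C f)"
  by (simp add: Hom_def)

lemma nat_transformation_Iden:
  assumes "cat_functor C D F"
  shows "nat_transformation C D F F (\<lambda>x\<in>Obj C. Iden D (FObj F x))"
proof -
  interpret cat_functor C D F by fact
  show ?thesis
    unfolding nat_transformation_def
    using FObj_in by (auto simp: D.Id_in PiE_iff D.Comp_Id_left[OF FArr_in] D.Comp_Id_right[OF FArr_in])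
qed

lemma nat_transformation_Comp:
  assumes "cat_functor C D F" "cat_functor C D G" "cat_functor C D H"
    and "nat_transformation C D F G \<sigma>" "nat_transformation C D G H \<tau>"
  shows "nat_transformation C D F H (\<lambda>x\<in>Obj C. \<tau> x \<cdot>\<^bsub>D\<^esub> \<sigma> x)"
proof -
  interpret F: cat_functor C D F by fact
  interpret G: cat_functor C D G by fact
  interpret H: cat_functor C D H by fact
  have \<sigma>: "\<sigma> x \<in> Hom D (FObj F x) (FObj G x)" and \<tau>: "\<tau> x \<in> Hom D (FObj G x) (FObj H x)"
    if "x \<in> Obj C" for x
    using assms(4,5) that by (auto simp: nat_transformation_def)
  have "(\<tau> y \<cdot>\<^bsub>D\<^esub> \<sigma> y) \<cdot>\<^bsub>D\<^esub> FArr F f = FArr H f \<cdot>\<^bsub>D\<^esub> (\<tau> x \<cdot>\<^bsub>D\<^esub> \<sigma> x)"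
    if xy: "x \<in> Obj C" "y \<in> Obj C" and f: "f \<in> Hom C x y" for x y f
  proof -
    have "(\<tau> y \<cdot>\<^bsub>D\<^esub> \<sigma> y) \<cdot>\<^bsub>D\<^esub> FArr F f = \<tau> y \<cdot>\<^bsub>D\<^esub> (\<sigma> y \<cdot>\<^bsub>D\<^esub> FArr F f)"
      by (rule F.D.Comp_assoc[OF F.FArr_in[OF f] \<sigma>[OF xy(2)] \<tau>[OF xy(2)]])
    also have "\<dots> = \<tau> y \<cdot>\<^bsub>D\<^esub> (FArr G f \<cdot>\<^bsub>D\<^esub> \<sigma> x)"
      using assms(4) xy f by (simp add: nat_transformation_def)
    also have "\<dots> = (\<tau> y \<cdot>\<^bsub>D\<^esub> FArr G f) \<cdot>\<^bsub>D\<^esub> \<sigma> x"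
      by (rule F.D.Comp_assoc[OF \<sigma>[OF xy(1)] G.FArr_in[OF f] \<tau>[OF xy(2)], symmetric])
    also have "\<dots> = (FArr H f \<cdot>\<^bsub>D\<^esub> \<tau> x) \<cdot>\<^bsub>D\<^esub> \<sigma> x"
      using assms(5) xy f by (simp add: nat_transformation_def)
    also have "\<dots> = FArr H f \<cdot>\<^bsub>D\<^esub> (\<tau> x \<cdot>\<^bsub>D\<^esub> \<sigma> x)"
      by (rule F.D.Comp_assoc[OF \<sigma>[OF xy(1)] \<tau>[OF xy(1)] H.FArr_in[OF f]])
    finally show ?thesis .
  qed
  then show ?thesis
    unfolding nat_transformation_def
    by (auto intro!: F.D.Comp_in[OF \<sigma> \<tau>])
qed

text \<open>Shared by \<open>Frob\<close> and \<open>Strict\<close>. Unit laws and associativity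
  hold componentwise in \<open>D\<close>, and extensionality of components turns them into
  equalities of functions; what is specific to each case is closure of \<open>T\<close> under
  identities and vertical composition.\<close>

lemma category_transformation_category:
  assumes P_functor: "\<And>F. P F \<Longrightarrow> cat_functor C D F"
    and nat: "\<And>F G \<sigma>. T F G \<sigma> \<Longrightarrow> nat_transformation C D F G \<sigma>"
    and T_Iden: "\<And>F. P F \<Longrightarrow> T F F (\<lambda>x\<in>Obj C. Iden D (FObj F x))"
    and T_Comp: "\<And>F G H \<sigma> \<tau>. P F \<Longrightarrow> P G \<Longrightarrow> P H \<Longrightarrow> T F G \<sigma> \<Longrightarrow> T G H \<tau> \<Longrightarrow>
      T F H (\<lambda>x\<in>Obj C. \<tau> x \<cdot>\<^bsub>D\<^esub> \<sigma> x)"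
  shows "category (transformation_category C D P T)"
proof -
  have comp: "\<tau> x \<in> Hom D (FObj F x) (FObj G x)" if "x \<in> Obj C" "T F G \<tau>" for x F G \<tau>
    using nat[OF that(2)] that(1) by (auto simp: nat_transformation_def)
  have ext: "\<tau> \<in> extensional (Obj C)" if "T F G \<tau>" for F G \<tau>
    using nat[OF that] by (auto simp: nat_transformation_def)
  \<comment> \<open>The axioms of \<open>D\<close> are extracted from any object satisfying
    \<open>P\<close>, since every functor carries them.\<close>
  have cat: "category D" if "P F" for F
    using P_functor[OF that] by (simp add: cat_functor_def)
  show ?thesis
    by unfold_locales
      (auto simp: transformation_category_def Hom_def[of "\<lparr>Obj = _, Arr = _, Dom = _, Cod = _, Iden = _, Comp = _\<rparr>"]
        T_Iden[unfolded restrict_def] fun_eq_iff restrict_def extensional_arb[OF ext]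
        category.Comp_Id_left[OF cat comp] category.Comp_Id_right[OF cat comp]
        category.Comp_assoc[OF cat comp comp comp]
        intro: T_Comp[unfolded restrict_def])
qed

text \<open>Functoriality is demanded in one direction only: an inverse of a functor that is
  bijective on objects and arrows is itself a functor.\<close>

lemma isomorphic_categoriesI:
  fixes A :: "('o, 'a, 'm) cat_data_scheme" and B :: "('p, 'b, 'n) cat_data_scheme"
  assumes "category A" "category B"
    and obj: "\<And>X. X \<in> Obj A \<Longrightarrow> \<phi> X \<in> Obj B" "\<And>Y. Y \<in> Obj B \<Longrightarrow> \<psi> Y \<in> Obj A"
      "\<And>X. X \<in> Obj A \<Longrightarrow> \<psi> (\<phi> X) = X" "\<And>Y. Y \<in> Obj B \<Longrightarrow> \<phi> (\<psi> Y) = Y"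
    and arr: "\<And>f X Y. f \<in> Hom A X Y \<Longrightarrow> \<alpha> f \<in> Hom B (\<phi> X) (\<phi> Y)" "\<And>g. g \<in> Arr B \<Longrightarrow> \<beta> g \<in> Arr A"
      "\<And>f. f \<in> Arr A \<Longrightarrow> \<beta> (\<alpha> f) = f" "\<And>g. g \<in> Arr B \<Longrightarrow> \<alpha> (\<beta> g) = g"
    and Iden: "\<And>X. X \<in> Obj A \<Longrightarrow> \<alpha> (Iden A X) = Iden B (\<phi> X)"
    and Comp: "\<And>f g X Y Z. f \<in> Hom A X Y \<Longrightarrow> g \<in> Hom A Y Z \<Longrightarrow> \<alpha> (g \<cdot>\<^bsub>A\<^esub> f) = \<alpha> g \<cdot>\<^bsub>B\<^esub> \<alpha> f"
  shows "isomorphic_categories A B"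
proof -
  interpret A: category A by fact
  interpret B: category B by fact
  define \<Phi> where "\<Phi> = \<lparr>FObj = restrict \<phi> (Obj A), FArr = restrict \<alpha> (Arr A)\<rparr>"
  define \<Psi> where "\<Psi> = \<lparr>FObj = restrict \<psi> (Obj B), FArr = restrict \<beta> (Arr B)\<rparr>"
  \<comment> \<open>Because \<open>\<alpha> (\<beta> g) = g\<close>, the map \<open>\<phi>\<close>
    sends the endpoints of \<open>\<beta> g\<close> to those of \<open>g\<close>; applying
    \<open>\<psi>\<close> identifies them.\<close>
  have \<beta>_in: "\<beta> g \<in> Hom A (\<psi> X) (\<psi> Y)" if "g \<in> Hom B X Y" for g X Y
  proof -
    note g = B.HomD[OF that]
    have \<beta>: "\<beta> g \<in> Hom A (Dom A (\<beta> g)) (Cod A (\<beta> g))"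
      using arr(2)[OF g(1)] by (rule A.Arr_Hom)
    from arr(1)[OF this] that have "\<phi> (Dom A (\<beta> g)) = X" "\<phi> (Cod A (\<beta> g)) = Y"
      by (auto simp: arr(4)[OF g(1)] Hom_def)
    with \<beta> obj(3)[OF A.HomD(2)[OF \<beta>]] obj(3)[OF A.HomD(3)[OF \<beta>]] show ?thesis by simp
  qed
  have \<Phi>: "cat_functor A B \<Phi>"
    by unfold_locales
      (auto simp: \<Phi>_def A.HomD obj arr Iden Comp A.HomD(1)[OF A.Comp_in])
  have \<beta>_Iden: "\<beta> (Iden B X) = Iden A (\<psi> X)" if "X \<in> Obj B" for X
    using arr(3)[of "Iden A (\<psi> X)"] that by (simp add: Iden obj)
  \<comment> \<open>Obtained by cancelling \<open>\<beta>\<close> against \<open>\<alpha>\<close> on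
    the composite \<open>\<beta> g \<cdot> \<beta> f\<close>, whose image under
    \<open>\<alpha>\<close> is the composite of \<open>g\<close> and \<open>f\<close>.\<close>
  have \<beta>_Comp: "\<beta> (g \<cdot>\<^bsub>B\<^esub> f) = \<beta> g \<cdot>\<^bsub>A\<^esub> \<beta> f" if "f \<in> Hom B X Y" "g \<in> Hom B Y Z" for f g X Y Z
    using arr(3)[of "\<beta> g \<cdot>\<^bsub>A\<^esub> \<beta> f"] A.HomD(1)[OF A.Comp_in[OF \<beta>_in[OF that(1)] \<beta>_in[OF that(2)]]]
    by (simp add: Comp[OF \<beta>_in[OF that(1)] \<beta>_in[OF that(2)]] arr(4) B.HomD(1)[OF that(1)]
        B.HomD(1)[OF that(2)])
  have \<Psi>: "cat_functor B A \<Psi>"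
    by unfold_locales
      (auto simp: \<Psi>_def B.HomD obj \<beta>_in \<beta>_Iden \<beta>_Comp B.HomD(1)[OF B.Comp_in])
  have "\<alpha> f \<in> Arr B" if "f \<in> Arr A" for f
    using arr(1)[OF A.Arr_Hom[OF that]] by (rule B.HomD(1))
  then show ?thesis
    unfolding isomorphic_categories_def
    using \<Phi> \<Psi> by (intro exI[of _ \<Phi>] exI[of _ \<Psi>]) (auto simp: \<Phi>_def \<Psi>_def obj arr)
qed

section \<open>The category of Frobenius functors\<close>

context frobenius_functor
begin

lemma mult_in: "x \<in> Obj C \<Longrightarrow> y \<in> Obj C \<Longrightarrow>
    lax_mult F (x, y) \<in> Hom D (FObj F x \<odot>\<^bsub>D\<^esub> FObj F y) (FObj F (x \<odot>\<^bsub>C\<^esub> y))"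
  and unit_in: "lax_unit F \<in> Hom D \<one>\<^bsub>D\<^esub> (FObj F \<one>\<^bsub>C\<^esub>)"
  using lax by (auto simp: lax_structure_def)

lemma comult_in: "x \<in> Obj C \<Longrightarrow> y \<in> Obj C \<Longrightarrow>
    oplax_comult F (x, y) \<in> Hom D (FObj F (x \<odot>\<^bsub>C\<^esub> y)) (FObj F x \<odot>\<^bsub>D\<^esub> FObj F y)"
  and counit_in: "oplax_counit F \<in> Hom D (FObj F \<one>\<^bsub>C\<^esub>) \<one>\<^bsub>D\<^esub>"
  using oplax by (auto simp: oplax_structure_def)

end

lemma frobenius_transformation_Iden:
  assumes "frobenius_functor C D F"
  shows "frobenius_transformation C D F F (\<lambda>x\<in>Obj C. Iden D (FObj F x))"
proof -
  interpret frobenius_functor C D F by fact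
  have obj: "FObj F x \<in> Obj D" if "x \<in> Obj C" for x
    using FObj_in that by auto
  have "nat_transformation C D F F (\<lambda>x\<in>Obj C. Iden D (FObj F x))"
    by (rule nat_transformation_Iden) unfold_locales
  then show ?thesis
    by (simp add: frobenius_transformation_def C.TensorO_in C.Unit_in D.Tensor_Id obj
        D.Comp_Id_left[OF mult_in] D.Comp_Id_right[OF mult_in] D.Comp_Id_left[OF unit_in]
        D.Comp_Id_left[OF comult_in] D.Comp_Id_right[OF comult_in] D.Comp_Id_right[OF counit_in])
qed

text \<open>Pasting of two commuting squares along the common edge \<open>n\<close>. It serves both
  for composites of transformations and for naturality at a composite term.\<close>

lemma (in category) Comp_square:
  assumes "\<sigma> \<in> Hom C x y" "\<tau> \<in> Hom C y z" "\<sigma>' \<in> Hom C x' y'" "\<tau>' \<in> Hom C y' z'"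
    and "m \<in> Hom C x x'" "n \<in> Hom C y y'" "k \<in> Hom C z z'"
    and "\<sigma>' \<cdot> m = n \<cdot> \<sigma>" "\<tau>' \<cdot> n = k \<cdot> \<tau>"
  shows "(\<tau>' \<cdot> \<sigma>') \<cdot> m = k \<cdot> (\<tau> \<cdot> \<sigma>)"
proof -
  have "(\<tau>' \<cdot> \<sigma>') \<cdot> m = (\<tau>' \<cdot> n) \<cdot> \<sigma>"
    using assms by (metis Comp_assoc)
  also have "\<dots> = k \<cdot> (\<tau> \<cdot> \<sigma>)"
    using assms(1,2,7) by (simp add: assms(9) Comp_assoc)
  finally show ?thesis .
qed

lemma frobenius_transformation_Comp:
  assumes "frobenius_functor C D F" "frobenius_functor C D G" "frobenius_functor C D H"
    and \<sigma>: "frobenius_transformation C D F G \<sigma>" and \<tau>: "frobenius_transformation C D G H \<tau>"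
  shows "frobenius_transformation C D F H (\<lambda>x\<in>Obj C. \<tau> x \<cdot>\<^bsub>D\<^esub> \<sigma> x)"
proof -
  interpret F: frobenius_functor C D F by fact
  interpret G: frobenius_functor C D G by fact
  interpret H: frobenius_functor C D H by fact
  have nat: "nat_transformation C D F H (\<lambda>x\<in>Obj C. \<tau> x \<cdot>\<^bsub>D\<^esub> \<sigma> x)"
    using \<sigma> \<tau> unfolding frobenius_transformation_def
    by (blast intro: nat_transformation_Comp F.cat_functor_axioms G.cat_functor_axioms
        H.cat_functor_axioms)
  have \<sigma>_in: "\<sigma> x \<in> Hom D (FObj F x) (FObj G x)" and \<tau>_in: "\<tau> x \<in> Hom D (FObj G x) (FObj H x)"
    if "x \<in> Obj C" for x
    using \<sigma> \<tau> that by (auto simp: frobenius_transformation_def nat_transformation_def)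
  note in_Hom = F.mult_in G.mult_in H.mult_in F.comult_in G.comult_in H.comult_in
  have mult: "(\<tau> (x \<odot>\<^bsub>C\<^esub> y) \<cdot>\<^bsub>D\<^esub> \<sigma> (x \<odot>\<^bsub>C\<^esub> y)) \<cdot>\<^bsub>D\<^esub> lax_mult F (x, y) =
      lax_mult H (x, y) \<cdot>\<^bsub>D\<^esub> ((\<tau> x \<cdot>\<^bsub>D\<^esub> \<sigma> x) \<otimes>\<^bsub>D\<^esub> (\<tau> y \<cdot>\<^bsub>D\<^esub> \<sigma> y))"
    and comult: "oplax_comult H (x, y) \<cdot>\<^bsub>D\<^esub> (\<tau> (x \<odot>\<^bsub>C\<^esub> y) \<cdot>\<^bsub>D\<^esub> \<sigma> (x \<odot>\<^bsub>C\<^esub> y)) =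
      ((\<tau> x \<cdot>\<^bsub>D\<^esub> \<sigma> x) \<otimes>\<^bsub>D\<^esub> (\<tau> y \<cdot>\<^bsub>D\<^esub> \<sigma> y)) \<cdot>\<^bsub>D\<^esub> oplax_comult F (x, y)"
    if xy: "x \<in> Obj C" "y \<in> Obj C" for x y
  proof -
    note xy' = F.C.TensorO_in[OF xy]
    \<comment> \<open>Interchange splits the tensor of composites, so that each compatibility
      becomes a pasting of the square for \<sigma> with the one for \<tau>.\<close>
    have ten: "(\<tau> x \<cdot>\<^bsub>D\<^esub> \<sigma> x) \<otimes>\<^bsub>D\<^esub> (\<tau> y \<cdot>\<^bsub>D\<^esub> \<sigma> y) = (\<tau> x \<otimes>\<^bsub>D\<^esub> \<tau> y) \<cdot>\<^bsub>D\<^esub> (\<sigma> x \<otimes>\<^bsub>D\<^esub> \<sigma> y)"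
      by (rule F.D.interchange[OF \<sigma>_in \<tau>_in \<sigma>_in \<tau>_in]) fact+
    note in_Hom' = \<sigma>_in[OF xy'] \<tau>_in[OF xy'] F.D.Tensor_in[OF \<sigma>_in \<sigma>_in, OF xy]
      F.D.Tensor_in[OF \<tau>_in \<tau>_in, OF xy]
    show "(\<tau> (x \<odot>\<^bsub>C\<^esub> y) \<cdot>\<^bsub>D\<^esub> \<sigma> (x \<odot>\<^bsub>C\<^esub> y)) \<cdot>\<^bsub>D\<^esub> lax_mult F (x, y) =
        lax_mult H (x, y) \<cdot>\<^bsub>D\<^esub> ((\<tau> x \<cdot>\<^bsub>D\<^esub> \<sigma> x) \<otimes>\<^bsub>D\<^esub> (\<tau> y \<cdot>\<^bsub>D\<^esub> \<sigma> y))"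
      unfolding ten
      by (rule F.D.Comp_square[OF in_Hom'(3,4,1,2), where n = "lax_mult G (x, y)"])
        (use \<sigma> \<tau> xy in \<open>auto simp: frobenius_transformation_def in_Hom\<close>)
    show "oplax_comult H (x, y) \<cdot>\<^bsub>D\<^esub> (\<tau> (x \<odot>\<^bsub>C\<^esub> y) \<cdot>\<^bsub>D\<^esub> \<sigma> (x \<odot>\<^bsub>C\<^esub> y)) =
        ((\<tau> x \<cdot>\<^bsub>D\<^esub> \<sigma> x) \<otimes>\<^bsub>D\<^esub> (\<tau> y \<cdot>\<^bsub>D\<^esub> \<sigma> y)) \<cdot>\<^bsub>D\<^esub> oplax_comult F (x, y)"
      unfolding ten
      \<comment> \<open>Comultiplications point the other way, so the tensored components now play
        the role of \<open>\<sigma>'\<close> and \<open>\<tau>'\<close> in the pasting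
        lemma.\<close>
      by (rule F.D.Comp_square[OF in_Hom'(1-4), where n = "oplax_comult G (x, y)", symmetric])
        (use \<sigma> \<tau> xy in \<open>auto simp: frobenius_transformation_def in_Hom\<close>)
  qed
  have unit: "(\<tau> \<one>\<^bsub>C\<^esub> \<cdot>\<^bsub>D\<^esub> \<sigma> \<one>\<^bsub>C\<^esub>) \<cdot>\<^bsub>D\<^esub> lax_unit F = lax_unit H"
    using \<sigma> \<tau>
    by (simp add: frobenius_transformation_def F.D.Comp_assoc[OF F.unit_in \<sigma>_in \<tau>_in] F.C.Unit_in)
  have counit: "oplax_counit H \<cdot>\<^bsub>D\<^esub> (\<tau> \<one>\<^bsub>C\<^esub> \<cdot>\<^bsub>D\<^esub> \<sigma> \<one>\<^bsub>C\<^esub>) = oplax_counit F"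
    using \<sigma> \<tau>
    by (simp add: frobenius_transformation_def F.D.Comp_assoc[OF \<sigma>_in \<tau>_in H.counit_in, symmetric]
        F.C.Unit_in)
  from nat mult comult unit counit show ?thesis
    by (simp add: frobenius_transformation_def F.C.TensorO_in F.C.Unit_in)
qed

lemma category_Frob: "category (Frob C D)"
  unfolding Frob_def
  by (rule category_transformation_category)
    (auto simp: frobenius_functor_def frobenius_transformation_Iden
      intro: frobenius_transformation_Comp, auto simp: frobenius_transformation_def)

section \<open>The category of strict monoidal functors\<close>

lemma monoidal_transformation_Iden:
  assumes "strict_monoidal_functor C D F"
  shows "monoidal_transformation C D F F (\<lambda>x\<in>Obj C. Iden D (FObj F x))"
proof -
  interpret strict_monoidal_functor C D F by fact
  have obj: "FObj F x \<in> Obj D" if "x \<in> Obj C" for x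
    using FObj_in that by auto
  show ?thesis
    unfolding monoidal_transformation_def
    by (auto simp: C.TensorO_in C.Unit_in D.Tensor_Id obj FObj_TensorO FObj_Unit
        intro!: nat_transformation_Iden cat_functor_axioms)
qed

lemma monoidal_transformation_Comp:
  assumes "strict_monoidal_functor C D F" "strict_monoidal_functor C D G"
    "strict_monoidal_functor C D H"
    and \<sigma>: "monoidal_transformation C D F G \<sigma>" and \<tau>: "monoidal_transformation C D G H \<tau>"
  shows "monoidal_transformation C D F H (\<lambda>x\<in>Obj C. \<tau> x \<cdot>\<^bsub>D\<^esub> \<sigma> x)"
proof -
  interpret F: strict_monoidal_functor C D F by fact
  interpret G: strict_monoidal_functor C D G by fact
  interpret H: strict_monoidal_functor C D H by fact
  have nat: "nat_transformation C D F H (\<lambda>x\<in>Obj C. \<tau> x \<cdot>\<^bsub>D\<^esub> \<sigma> x)"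
    using \<sigma> \<tau> unfolding monoidal_transformation_def
    by (blast intro: nat_transformation_Comp F.cat_functor_axioms G.cat_functor_axioms
        H.cat_functor_axioms)
  have \<sigma>_in: "\<sigma> x \<in> Hom D (FObj F x) (FObj G x)" and \<tau>_in: "\<tau> x \<in> Hom D (FObj G x) (FObj H x)"
    if "x \<in> Obj C" for x
    using \<sigma> \<tau> that by (auto simp: monoidal_transformation_def nat_transformation_def)
  from nat \<sigma> \<tau> show ?thesis
    by (simp add: monoidal_transformation_def F.C.TensorO_in F.C.Unit_in
        F.D.interchange[OF \<sigma>_in \<tau>_in \<sigma>_in \<tau>_in] F.D.Comp_Id_left[OF F.D.Id_in] F.D.Unit_in)
qed

lemma category_Strict: "category (Strict C D)"
  unfolding Strict_def
  by (rule category_transformation_category)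
    (auto simp: strict_monoidal_functor_def monoidal_transformation_Iden
      intro: monoidal_transformation_Comp, auto simp: monoidal_transformation_def)

section \<open>Tensor products of lists\<close>

text \<open>The fold ends in the unit, so a one-letter list yields the value of its letter tensored
  with the unit. This is why the right unit law recurs whenever a generator is evaluated.\<close>

definition tensor_objs :: "('p, 'b, 'n) smc_data_scheme \<Rightarrow> ('o \<Rightarrow> 'p) \<Rightarrow> 'o list \<Rightarrow> 'p" where
  "tensor_objs D \<phi> X = foldr (\<lambda>x y. \<phi> x \<odot>\<^bsub>D\<^esub> y) X \<one>\<^bsub>D\<^esub>"

definition tensor_arrs :: "('p, 'b, 'n) smc_data_scheme \<Rightarrow> ('o \<Rightarrow> 'b) \<Rightarrow> 'o list \<Rightarrow> 'b" where
  "tensor_arrs D \<sigma> X = foldr (\<lambda>x g. \<sigma> x \<otimes>\<^bsub>D\<^esub> g) X (Iden D \<one>\<^bsub>D\<^esub>)"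

lemma tensor_objs_simps [simp]:
  "tensor_objs D \<phi> [] = \<one>\<^bsub>D\<^esub>"
  "tensor_objs D \<phi> (x # X) = \<phi> x \<odot>\<^bsub>D\<^esub> tensor_objs D \<phi> X"
  by (simp_all add: tensor_objs_def)

lemma tensor_arrs_simps [simp]:
  "tensor_arrs D \<sigma> [] = Iden D \<one>\<^bsub>D\<^esub>"
  "tensor_arrs D \<sigma> (x # X) = \<sigma> x \<otimes>\<^bsub>D\<^esub> tensor_arrs D \<sigma> X"
  by (simp_all add: tensor_arrs_def)

text \<open>Allows a family restricted to \<open>Obj C\<close> to be replaced by the unrestricted
  one inside the fold.\<close>

lemma tensor_arrs_cong: "(\<And>x. x \<in> set X \<Longrightarrow> \<sigma> x = \<tau> x) \<Longrightarrow> tensor_arrs D \<sigma> X = tensor_arrs D \<tau> X"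
  by (induction X) auto

context strict_monoidal_category
begin

lemma tensor_objs_in: "(\<And>x. x \<in> set X \<Longrightarrow> \<phi> x \<in> Obj C) \<Longrightarrow> tensor_objs C \<phi> X \<in> Obj C"
  by (induction X) (auto intro: Unit_in TensorO_in)

text \<open>Concatenation is the tensor product of the classifier, so this is strict monoidality of
  the extension on objects.\<close>

lemma tensor_objs_append:
  "(\<And>x. x \<in> set X \<union> set Y \<Longrightarrow> \<phi> x \<in> Obj C) \<Longrightarrow>
    tensor_objs C \<phi> (X @ Y) = tensor_objs C \<phi> X \<odot> tensor_objs C \<phi> Y"
  by (induction X) (auto simp: TensorO_Unit_left TensorO_assoc tensor_objs_in)

lemma tensor_arrs_in:
  "(\<And>x. x \<in> set X \<Longrightarrow> \<sigma> x \<in> Hom C (\<phi> x) (\<psi> x)) \<Longrightarrow>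
    tensor_arrs C \<sigma> X \<in> Hom C (tensor_objs C \<phi> X) (tensor_objs C \<psi> X)"
  by (induction X) (auto intro: Unit_in Id_in Tensor_in)

lemma tensor_arrs_in_Arr: "(\<And>x. x \<in> set X \<Longrightarrow> \<sigma> x \<in> Arr C) \<Longrightarrow> tensor_arrs C \<sigma> X \<in> Arr C"
  by (rule HomD(1), rule tensor_arrs_in, rule Arr_Hom)

lemma tensor_arrs_append:
  "(\<And>x. x \<in> set X \<union> set Y \<Longrightarrow> \<sigma> x \<in> Arr C) \<Longrightarrow>
    tensor_arrs C \<sigma> (X @ Y) = tensor_arrs C \<sigma> X \<otimes> tensor_arrs C \<sigma> Y"
  by (induction X) (auto simp: Tensor_Unit_left Tensor_assoc tensor_arrs_in_Arr)

lemma tensor_arrs_Iden: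
  "(\<And>x. x \<in> set X \<Longrightarrow> \<phi> x \<in> Obj C) \<Longrightarrow>
    tensor_arrs C (\<lambda>x. Iden C (\<phi> x)) X = Iden C (tensor_objs C \<phi> X)"
  by (induction X) (auto simp: Tensor_Id tensor_objs_in)

text \<open>Interchange applied letter by letter; it will make the extension of transformations
  respect vertical composition.\<close>

lemma tensor_arrs_Comp:
  "(\<And>x. x \<in> set X \<Longrightarrow> \<sigma> x \<in> Hom C (\<phi> x) (\<psi> x)) \<Longrightarrow>
    (\<And>x. x \<in> set X \<Longrightarrow> \<tau> x \<in> Hom C (\<psi> x) (\<chi> x)) \<Longrightarrow>
    tensor_arrs C (\<lambda>x. \<tau> x \<cdot> \<sigma> x) X = tensor_arrs C \<tau> X \<cdot> tensor_arrs C \<sigma> X"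
proof (induction X)
  case Nil
  show ?case by (simp add: Comp_Id_left[OF Id_in] Unit_in)
next
  case (Cons x X)
  have "(\<tau> x \<cdot> \<sigma> x) \<otimes> (tensor_arrs C \<tau> X \<cdot> tensor_arrs C \<sigma> X) =
      (\<tau> x \<otimes> tensor_arrs C \<tau> X) \<cdot> (\<sigma> x \<otimes> tensor_arrs C \<sigma> X)"
    by (rule interchange[OF _ _ tensor_arrs_in tensor_arrs_in]) (use Cons.prems in auto)
  with Cons show ?case by simp
qed

end

section \<open>Extending a Frobenius functor to the classifier\<close>

text \<open>Total on raw terms, ill-formed ones included. Typing (\<open>eval_fterm_in\<close>) and
  independence of the representative (\<open>eval_fterm_cong\<close>) are separate facts about
  well-formed terms.\<close>

primrec eval_fterm :: "('p, 'b, 'n) smc_data_scheme \<Rightarrow> ('o, 'a, 'p, 'b) frob_functor_data \<Rightarrow>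
    ('o, 'a) fterm \<Rightarrow> 'b" where
  "eval_fterm D F (FId X) = Iden D (tensor_objs D (FObj F) X)"
| "eval_fterm D F (FGen f) = FArr F f"
| "eval_fterm D F (FL x z) = lax_mult F (x, z)"
| "eval_fterm D F (FK x z) = oplax_comult F (x, z)"
| "eval_fterm D F FJ = lax_unit F"
| "eval_fterm D F FQ = oplax_counit F"
| "eval_fterm D F (t \<bullet> s) = eval_fterm D F t \<cdot>\<^bsub>D\<^esub> eval_fterm D F s"
| "eval_fterm D F (t \<diamondop> s) = eval_fterm D F t \<otimes>\<^bsub>D\<^esub> eval_fterm D F s"

definition extend_functor :: "('o, 'a, 'm) smc_data_scheme \<Rightarrow> ('p, 'b, 'n) smc_data_scheme \<Rightarrow>
    ('o, 'a, 'p, 'b) frob_functor_data \<Rightarrow> ('o list, ('o, 'a) fterm set, 'p, 'b) functor_data" where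
  "extend_functor C D F =
    \<lparr> FObj = \<lambda>X\<in>lists (Obj C). tensor_objs D (FObj F) X,
      FArr = \<lambda>A\<in>Arr (Frobenius_classifier C). eval_fterm D F (frep A) \<rparr>"

context frobenius_functor
begin

lemma FObj_in_Obj: "x \<in> Obj C \<Longrightarrow> FObj F x \<in> Obj D"
  using FObj_in by auto

lemma tensor_FObj_in: "X \<in> lists (Obj C) \<Longrightarrow> tensor_objs D (FObj F) X \<in> Obj D"
  by (auto intro: D.tensor_objs_in FObj_in_Obj)

lemma tensor_FObj_append: "X \<in> lists (Obj C) \<Longrightarrow> Y \<in> lists (Obj C) \<Longrightarrow>
    tensor_objs D (FObj F) (X @ Y) = tensor_objs D (FObj F) X \<odot>\<^bsub>D\<^esub> tensor_objs D (FObj F) Y"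
  by (rule D.tensor_objs_append) (auto intro: FObj_in_Obj)

lemma eval_fterm_in:
  "fwf C t \<Longrightarrow>
    eval_fterm D F t \<in> Hom D (tensor_objs D (FObj F) (fdom C t)) (tensor_objs D (FObj F) (fcod C t))"
proof (induction t)
  case (FId X)
  then show ?case by (simp add: D.Id_in tensor_FObj_in)
next
  case (FGen f)
  then show ?case
    by (simp add: FArr_in C.Arr_Hom D.TensorO_Unit_right FObj_in_Obj C.Dom_in C.Cod_in)
next
  case (FTen t s)
  then show ?case
    by (simp add: tensor_FObj_append C.fdom_fcod_in D.Tensor_in)
qed (auto simp: D.TensorO_Unit_right FObj_in_Obj C.TensorO_in C.Unit_in mult_in comult_in unit_in
    counit_in intro: D.Comp_in)

text \<open>With free endpoints, the middle object of a composite can be matched from either of its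
  two factors.\<close>

lemma eval_fterm_in_Hom: "fwf C t \<Longrightarrow> fdom C t = X \<Longrightarrow> fcod C t = Y \<Longrightarrow>
    eval_fterm D F t \<in> Hom D (tensor_objs D (FObj F) X) (tensor_objs D (FObj F) Y)"
  using eval_fterm_in by blast

lemma eval_fterm_in_Arr: "fwf C t \<Longrightarrow> eval_fterm D F t \<in> Arr D"
  by (rule D.HomD(1)[OF eval_fterm_in])

text \<open>Well-definedness on classes. Every rule of \<open>feq\<close> is a rule of equality, a
  strict monoidal axiom valid in \<open>D\<close>, or a relation whose image is functoriality or an
  axiom of a Frobenius functor.\<close>

lemma eval_fterm_cong: "feq C t s \<Longrightarrow> eval_fterm D F t = eval_fterm D F s"
proof (induction rule: feq.induct)
  case (feq_comp_id_left t)
  then show ?case by (simp add: D.Comp_Id_left[OF eval_fterm_in])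
next
  case (feq_comp_id_right t)
  then show ?case by (simp add: D.Comp_Id_right[OF eval_fterm_in])
next
  case (feq_comp_assoc r t s)
  then show ?case
    using D.Comp_assoc[OF eval_fterm_in[of s] eval_fterm_in_Hom[of t] eval_fterm_in_Hom[of r]]
    by simp
next
  case (feq_ten_id X Y)
  then show ?case by (simp add: D.Tensor_Id tensor_FObj_in tensor_FObj_append)
next
  case (feq_ten_comp t s t' s')
  then show ?case
    using D.interchange[OF eval_fterm_in[of s] eval_fterm_in_Hom[of t] eval_fterm_in[of s']
        eval_fterm_in_Hom[of t']]
    by simp
next
  case (feq_ten_assoc t s r)
  then show ?case by (simp add: D.Tensor_assoc eval_fterm_in_Arr)
next
  case (feq_ten_unit_left t)
  then show ?case by (simp add: D.Tensor_Unit_left eval_fterm_in_Arr)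
next
  case (feq_ten_unit_right t)
  then show ?case by (simp add: D.Tensor_Unit_right eval_fterm_in_Arr)
next
  case (feq_gen_id x)
  then show ?case by (simp add: FArr_Id D.TensorO_Unit_right FObj_in_Obj)
next
  case (feq_gen_comp f x y g z)
  then show ?case by (simp add: FArr_Comp)
next
  case (feq_l_nat f x y f' x' y')
  then show ?case using lax C.HomD by (auto simp: lax_structure_def)
next
  case (feq_k_nat f x y f' x' y')
  then show ?case using oplax C.HomD by (auto simp: oplax_structure_def)
\<comment> \<open>What remains are the equivalence and congruence rules and the associativity, unit
  and Frobenius relations. The right unit law turns the evaluated \<open>FId [x]\<close> into the
  identity of \<open>FObj F x\<close>.\<close>
qed (use lax oplax in \<open>auto simp: lax_structure_def oplax_structure_def D.TensorO_Unit_right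
    FObj_in_Obj C.TensorO_in Frobenius_left Frobenius_right\<close>)

text \<open>Eliminates \<open>frep\<close>: on the class of a term the extension is the value of
  that very term.\<close>

lemma extend_functor_simps:
  "X \<in> lists (Obj C) \<Longrightarrow> FObj (extend_functor C D F) X = tensor_objs D (FObj F) X"
  "fwf C t \<Longrightarrow> FArr (extend_functor C D F) (fclass C t) = eval_fterm D F t"
  using eval_fterm_cong[OF C.frep] by (auto simp: extend_functor_def C.FC_simps)

lemma strict_monoidal_functor_extend_functor:
  "strict_monoidal_functor (Frobenius_classifier C) D (extend_functor C D F)"
proof -
  interpret FC: strict_monoidal_category "Frobenius_classifier C"
    by (rule C.strict_monoidal_category_Frobenius_classifier)
  let ?E = "extend_functor C D F"
  show ?thesis
  proof unfold_locales
    show "FObj ?E \<in> Obj (Frobenius_classifier C) \<rightarrow>\<^sub>E Obj D"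
      by (auto simp: extend_functor_def C.FC_simps tensor_FObj_in)
    show "FArr ?E \<in> extensional (Arr (Frobenius_classifier C))"
      by (simp add: extend_functor_def)
  next
    fix f X Y assume "f \<in> Hom (Frobenius_classifier C) X Y"
    then show "FArr ?E f \<in> Hom D (FObj ?E X) (FObj ?E Y)"
      using C.fdom_fcod_in by (auto simp: C.FC_Hom extend_functor_simps eval_fterm_in)
  next
    fix X assume "X \<in> Obj (Frobenius_classifier C)"
    then show "FArr ?E (Iden (Frobenius_classifier C) X) = Iden D (FObj ?E X)"
      by (simp add: C.FC_simps extend_functor_simps)
  next
    fix f g X Y Z
    assume "f \<in> Hom (Frobenius_classifier C) X Y" "g \<in> Hom (Frobenius_classifier C) Y Z"
    then show "FArr ?E (g \<cdot>\<^bsub>Frobenius_classifier C\<^esub> f) = FArr ?E g \<cdot>\<^bsub>D\<^esub> FArr ?E f"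
      by (auto simp: C.FC_Hom C.FC_Comp extend_functor_simps)
  next
    show "FObj ?E \<one>\<^bsub>Frobenius_classifier C\<^esub> = \<one>\<^bsub>D\<^esub>"
      by (simp add: C.FC_simps extend_functor_simps)
  next
    fix X Y assume "X \<in> Obj (Frobenius_classifier C)" "Y \<in> Obj (Frobenius_classifier C)"
    then show "FObj ?E (X \<odot>\<^bsub>Frobenius_classifier C\<^esub> Y) = FObj ?E X \<odot>\<^bsub>D\<^esub> FObj ?E Y"
      by (simp add: C.FC_simps extend_functor_simps tensor_FObj_append del: in_lists_conv_set)
  next
    fix f g assume "f \<in> Arr (Frobenius_classifier C)" "g \<in> Arr (Frobenius_classifier C)"
    then show "FArr ?E (f \<otimes>\<^bsub>Frobenius_classifier C\<^esub> g) = FArr ?E f \<otimes>\<^bsub>D\<^esub> FArr ?E g"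
      by (auto simp: C.FC_simps C.FC_Tensor extend_functor_simps)
  qed
qed

end

section \<open>Restricting a strict monoidal functor to the generators\<close>

definition restrict_functor :: "('o, 'a, 'm) smc_data_scheme \<Rightarrow>
    ('o list, ('o, 'a) fterm set, 'p, 'b) functor_data \<Rightarrow> ('o, 'a, 'p, 'b) frob_functor_data" where
  "restrict_functor C G =
    \<lparr> FObj = \<lambda>x\<in>Obj C. FObj G [x],
      FArr = \<lambda>f\<in>Arr C. FArr G (fclass C (FGen f)),
      lax_mult = \<lambda>(x, z)\<in>Obj C \<times> Obj C. FArr G (fclass C (FL x z)),
      lax_unit = FArr G (fclass C FJ),
      oplax_comult = \<lambda>(x, z)\<in>Obj C \<times> Obj C. FArr G (fclass C (FK x z)),
      oplax_counit = FArr G (fclass C FQ) \<rparr>"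

text \<open>The axioms of \<open>C\<close> are listed separately because those of \<open>G\<close>
  concern the classifier of \<open>C\<close> only.\<close>

locale classifier_functor =
  C: strict_monoidal_category C + D: strict_monoidal_category D + G: strict_monoidal_functor "Frobenius_classifier C" D G
  for C :: "('o, 'a, 'm) smc_data_scheme"
    and D :: "('p, 'b, 'n) smc_data_scheme"
    and G :: "('o list, ('o, 'a) fterm set, 'p, 'b) functor_data"
begin

lemma FObj_in_Obj: "X \<in> lists (Obj C) \<Longrightarrow> FObj G X \<in> Obj D"
  using G.FObj_in by (auto simp: C.FC_simps)

lemma FObj_append: "X \<in> lists (Obj C) \<Longrightarrow> Y \<in> lists (Obj C) \<Longrightarrow>
    FObj G (X @ Y) = FObj G X \<odot>\<^bsub>D\<^esub> FObj G Y"
  using G.FObj_TensorO by (simp add: C.FC_simps del: in_lists_conv_set)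

lemma FObj_Nil: "FObj G [] = \<one>\<^bsub>D\<^esub>"
  using G.FObj_Unit by (simp add: C.FC_simps)

lemma FObj_pair: "x \<in> Obj C \<Longrightarrow> y \<in> Obj C \<Longrightarrow> FObj G [x, y] = FObj G [x] \<odot>\<^bsub>D\<^esub> FObj G [y]"
  using FObj_append[of "[x]" "[y]"] by simp

lemma FArr_fclass_in: "fwf C t \<Longrightarrow> FArr G (fclass C t) \<in> Hom D (FObj G (fdom C t)) (FObj G (fcod C t))"
  by (rule G.FArr_in) (auto simp: C.FC_Hom)

lemma FArr_fclass_Id: "X \<in> lists (Obj C) \<Longrightarrow> FArr G (fclass C (FId X)) = Iden D (FObj G X)"
  using G.FArr_Id[of X] by (simp add: C.FC_simps)

lemma FArr_fclass_Comp: "fwf C (t \<bullet> s) \<Longrightarrow>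
    FArr G (fclass C (t \<bullet> s)) = FArr G (fclass C t) \<cdot>\<^bsub>D\<^esub> FArr G (fclass C s)"
  using G.FArr_Comp[of "fclass C s" "fdom C s" "fcod C s" "fclass C t" "fcod C t"]
  by (auto simp: C.FC_Hom C.FC_Comp)

lemma FArr_fclass_Tensor: "fwf C t \<Longrightarrow> fwf C s \<Longrightarrow>
    FArr G (fclass C (t \<diamondop> s)) = FArr G (fclass C t) \<otimes>\<^bsub>D\<^esub> FArr G (fclass C s)"
  using G.FArr_Tensor[of "fclass C t" "fclass C s"] by (simp add: C.FC_simps C.FC_Tensor)

lemmas FArr_fclass_simps = FArr_fclass_Id FArr_fclass_Comp FArr_fclass_Tensor

text \<open>Turns each defining relation of the classifier into an equation in
  \<open>D\<close>.\<close>

lemma FArr_fclass_cong: "feq C t s \<Longrightarrow> FArr G (fclass C t) = FArr G (fclass C s)"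
  by (simp add: C.fclass_eq)

lemma restrict_functor_simps:
  "x \<in> Obj C \<Longrightarrow> FObj (restrict_functor C G) x = FObj G [x]"
  "f \<in> Arr C \<Longrightarrow> FArr (restrict_functor C G) f = FArr G (fclass C (FGen f))"
  "x \<in> Obj C \<Longrightarrow> z \<in> Obj C \<Longrightarrow> lax_mult (restrict_functor C G) (x, z) = FArr G (fclass C (FL x z))"
  "x \<in> Obj C \<Longrightarrow> z \<in> Obj C \<Longrightarrow> oplax_comult (restrict_functor C G) (x, z) = FArr G (fclass C (FK x z))"
  "lax_unit (restrict_functor C G) = FArr G (fclass C FJ)"
  "oplax_counit (restrict_functor C G) = FArr G (fclass C FQ)"
  by (simp_all add: restrict_functor_def)

lemma cat_functor_restrict_functor: "cat_functor C D (restrict_functor C G)"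
proof unfold_locales
  show "FObj (restrict_functor C G) \<in> Obj C \<rightarrow>\<^sub>E Obj D"
    by (auto simp: restrict_functor_def FObj_in_Obj)
  show "FArr (restrict_functor C G) \<in> extensional (Arr C)"
    by (simp add: restrict_functor_def)
next
  fix f x y assume "f \<in> Hom C x y"
  then show "FArr (restrict_functor C G) f \<in>
      Hom D (FObj (restrict_functor C G) x) (FObj (restrict_functor C G) y)"
    using FArr_fclass_in[of "FGen f"] by (simp add: restrict_functor_simps C.HomD[OF \<open>f \<in> Hom C x y\<close>])
next
  fix x assume "x \<in> Obj C"
  then show "FArr (restrict_functor C G) (Iden C x) = Iden D (FObj (restrict_functor C G) x)"
    using FArr_fclass_cong[OF feq_gen_id[of x]] by (simp add: restrict_functor_simps FArr_fclass_simps)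
next
  fix f g x y z assume fg: "f \<in> Hom C x y" "g \<in> Hom C y z"
  then show "FArr (restrict_functor C G) (g \<cdot>\<^bsub>C\<^esub> f) =
      FArr (restrict_functor C G) g \<cdot>\<^bsub>D\<^esub> FArr (restrict_functor C G) f"
    using FArr_fclass_cong[OF feq_gen_comp[OF fg]]
      C.HomD[OF fg(1)] C.HomD[OF fg(2)] C.HomD[OF C.Comp_in[OF fg]]
    by (simp add: restrict_functor_simps FArr_fclass_simps)
qed

text \<open>Apply \<open>G\<close> to each defining relation and push it through composites, tensor
  products and identities: the result is the corresponding axiom for the restricted data.\<close>

lemma frobenius_functor_restrict_functor: "frobenius_functor C D (restrict_functor C G)"
proof -
  interpret R: cat_functor C D "restrict_functor C G"
    by (rule cat_functor_restrict_functor)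
  note simps = restrict_functor_simps FArr_fclass_simps C.HomD(1) C.TensorO_in C.Unit_in
  have FL_in: "FArr G (fclass C (FL x y)) \<in> Hom D (FObj G [x] \<odot>\<^bsub>D\<^esub> FObj G [y]) (FObj G [x \<odot>\<^bsub>C\<^esub> y])"
    and FK_in: "FArr G (fclass C (FK x y)) \<in> Hom D (FObj G [x \<odot>\<^bsub>C\<^esub> y]) (FObj G [x] \<odot>\<^bsub>D\<^esub> FObj G [y])"
    if "x \<in> Obj C" "y \<in> Obj C" for x y
    using that FArr_fclass_in[of "FL x y"] FArr_fclass_in[of "FK x y"] by (simp_all add: FObj_pair)
  have FJ_in: "FArr G (fclass C FJ) \<in> Hom D \<one>\<^bsub>D\<^esub> (FObj G [\<one>\<^bsub>C\<^esub>])"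
    and FQ_in: "FArr G (fclass C FQ) \<in> Hom D (FObj G [\<one>\<^bsub>C\<^esub>]) \<one>\<^bsub>D\<^esub>"
    using FArr_fclass_in[of FJ] FArr_fclass_in[of FQ] by (simp_all add: FObj_Nil)
  \<comment> \<open>Naturality is prepared apart because pushing \<open>G\<close> through the two
    sides requires well-formedness, which rests on the endpoints of \<open>f\<close>,
    \<open>f'\<close> and their tensor product.\<close>
  have FL_nat: "FArr G (fclass C (FL y y')) \<cdot>\<^bsub>D\<^esub>
        (FArr G (fclass C (FGen f)) \<otimes>\<^bsub>D\<^esub> FArr G (fclass C (FGen f'))) =
      FArr G (fclass C (FGen (f \<otimes>\<^bsub>C\<^esub> f'))) \<cdot>\<^bsub>D\<^esub> FArr G (fclass C (FL x x'))"
    and FK_nat: "(FArr G (fclass C (FGen f)) \<otimes>\<^bsub>D\<^esub> FArr G (fclass C (FGen f'))) \<cdot>\<^bsub>D\<^esub>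
        FArr G (fclass C (FK x x')) =
      FArr G (fclass C (FK y y')) \<cdot>\<^bsub>D\<^esub> FArr G (fclass C (FGen (f \<otimes>\<^bsub>C\<^esub> f')))"
    if "f \<in> Hom C x y" "f' \<in> Hom C x' y'" for f f' x y x' y'
    using FArr_fclass_cong[OF feq_l_nat[OF that]] FArr_fclass_cong[OF feq_k_nat[OF that]]
      C.HomD[OF that(1)] C.HomD[OF that(2)] C.HomD[OF C.Tensor_in[OF that]]
    by (simp_all add: FArr_fclass_simps)
  let ?R = "restrict_functor C G"
  show ?thesis
  proof unfold_locales
    have "lax_mult ?R \<in> extensional (Obj C \<times> Obj C)"
      by (simp add: restrict_functor_def)
    then show "lax_structure C D ?R (lax_mult ?R) (lax_unit ?R)"
      unfolding lax_structure_def
      using FArr_fclass_cong[OF feq_l_assoc[of _ C]]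
        FArr_fclass_cong[OF feq_l_unit_left[of _ C]] FArr_fclass_cong[OF feq_l_unit_right[of _ C]]
      by (simp add: simps FL_in FJ_in FL_nat C.HomD(1)[OF C.Tensor_in])
    have "oplax_comult ?R \<in> extensional (Obj C \<times> Obj C)"
      by (simp add: restrict_functor_def)
    then show "oplax_structure C D ?R (oplax_comult ?R) (oplax_counit ?R)"
      unfolding oplax_structure_def
      using FArr_fclass_cong[OF feq_k_assoc[of _ C]]
        FArr_fclass_cong[OF feq_k_unit_left[of _ C]] FArr_fclass_cong[OF feq_k_unit_right[of _ C]]
      by (simp add: simps FK_in FQ_in FK_nat C.HomD(1)[OF C.Tensor_in] C.TensorO_assoc C.TensorO_Unit_left C.TensorO_Unit_right)
  next
    fix x y z assume xyz: "x \<in> Obj C" "y \<in> Obj C" "z \<in> Obj C"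
    show "(lax_mult ?R (x, y) \<otimes>\<^bsub>D\<^esub> Iden D (FObj ?R z)) \<cdot>\<^bsub>D\<^esub> (Iden D (FObj ?R x) \<otimes>\<^bsub>D\<^esub> oplax_comult ?R (y, z)) =
        oplax_comult ?R (x \<odot>\<^bsub>C\<^esub> y, z) \<cdot>\<^bsub>D\<^esub> lax_mult ?R (x, y \<odot>\<^bsub>C\<^esub> z)"
      using FArr_fclass_cong[OF feq_frob_left[OF xyz]] xyz by (simp add: simps C.TensorO_assoc)
    show "(Iden D (FObj ?R x) \<otimes>\<^bsub>D\<^esub> lax_mult ?R (y, z)) \<cdot>\<^bsub>D\<^esub> (oplax_comult ?R (x, y) \<otimes>\<^bsub>D\<^esub> Iden D (FObj ?R z)) =
        oplax_comult ?R (x, y \<odot>\<^bsub>C\<^esub> z) \<cdot>\<^bsub>D\<^esub> lax_mult ?R (x \<odot>\<^bsub>C\<^esub> y, z)"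
      using FArr_fclass_cong[OF feq_frob_right[OF xyz]] xyz by (simp add: simps C.TensorO_assoc)
  qed
qed

lemma tensor_objs_restrict_functor:
  "X \<in> lists (Obj C) \<Longrightarrow> tensor_objs D (FObj (restrict_functor C G)) X = FObj G X"
proof (induction X)
  case (Cons x X)
  then show ?case
    using FObj_append[of "[x]" X] by (simp add: restrict_functor_simps)
qed (simp add: FObj_Nil)

text \<open>The uniqueness half of the universal property: \<open>G\<close> preserves every term
  former, so its values on generators determine it.\<close>

lemma eval_fterm_restrict_functor:
  "fwf C t \<Longrightarrow> eval_fterm D (restrict_functor C G) t = FArr G (fclass C t)"
  by (induction t)
    (auto simp: restrict_functor_simps FArr_fclass_simps tensor_objs_restrict_functor)

lemma extend_restrict_functor: "extend_functor C D (restrict_functor C G) = G"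
proof -
  interpret R: frobenius_functor C D "restrict_functor C G"
    by (rule frobenius_functor_restrict_functor)
  let ?E = "extend_functor C D (restrict_functor C G)"
  have "FObj ?E X = FObj G X" for X
  proof (cases "X \<in> lists (Obj C)")
    case True
    then show ?thesis by (simp add: R.extend_functor_simps tensor_objs_restrict_functor)
  next
    \<comment> \<open>Off the carrier both sides are \<open>undefined\<close>, by extensionality of
      \<open>G\<close> and by the restriction in the extension.\<close>
    case False
    then show ?thesis using G.FObj_in PiE_arb[of "FObj G"] by (simp add: extend_functor_def C.FC_simps)
  qed
  moreover have "FArr ?E A = FArr G A" for A
  proof (cases "A \<in> Arr (Frobenius_classifier C)")
    case True
    then show ?thesis
      by (auto simp: C.FC_simps R.extend_functor_simps eval_fterm_restrict_functor)
  next
    case False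
    then show ?thesis using extensional_arb[OF G.FArr_ext False] by (simp add: extend_functor_def)
  qed
  ultimately show ?thesis by (intro functor_data.equality) auto
qed

end

text \<open>Generators evaluate to the data of \<open>F\<close> by definition; on objects the
  trailing unit is absorbed. Extensionality of every field covers arguments outside the
  carriers.\<close>

lemma (in frobenius_functor) restrict_extend_functor:
  "restrict_functor C (extend_functor C D F) = F"
proof -
  let ?R = "restrict_functor C (extend_functor C D F)"
  have "FObj ?R x = FObj F x" for x
    using PiE_arb[OF FObj_in, of x]
    by (auto simp: restrict_functor_def extend_functor_simps restrict_def D.TensorO_Unit_right FObj_in_Obj)
  moreover have "FArr ?R f = FArr F f" for f
    using extensional_arb[OF FArr_ext, of f]
    by (auto simp: restrict_functor_def extend_functor_simps restrict_def)
  moreover have "lax_mult ?R p = lax_mult F p" for p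
    using lax extensional_arb[of "lax_mult F" _ p]
    by (cases p) (auto simp: restrict_functor_def extend_functor_simps restrict_def lax_structure_def)
  moreover have "oplax_comult ?R p = oplax_comult F p" for p
    using oplax extensional_arb[of "oplax_comult F" _ p]
    by (cases p) (auto simp: restrict_functor_def extend_functor_simps restrict_def oplax_structure_def)
  moreover have "lax_unit ?R = lax_unit F" "oplax_counit ?R = oplax_counit F"
    by (simp_all add: restrict_functor_def extend_functor_simps)
  ultimately show ?thesis by (intro frob_functor_data.equality) auto
qed

section \<open>Transformations\<close>

definition extend_transformation :: "('o, 'a, 'm) smc_data_scheme \<Rightarrow> ('p, 'b, 'n) smc_data_scheme \<Rightarrow>
    ('o \<Rightarrow> 'b) \<Rightarrow> 'o list \<Rightarrow> 'b" where
  "extend_transformation C D \<sigma> = (\<lambda>X\<in>lists (Obj C). tensor_arrs D \<sigma> X)"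

definition restrict_transformation :: "('o, 'a, 'm) smc_data_scheme \<Rightarrow> ('o list \<Rightarrow> 'b) \<Rightarrow> 'o \<Rightarrow> 'b" where
  "restrict_transformation C \<tau> = (\<lambda>x\<in>Obj C. \<tau> [x])"

text \<open>Exactly the condition for \<open>(F, G, \<sigma>)\<close> to be an arrow of
  \<open>Frob C D\<close>, so its facts apply to arrows directly.\<close>

locale frobenius_transf = F: frobenius_functor C D F + G: frobenius_functor C D G
  for C :: "('o, 'a, 'm) smc_data_scheme"
    and D :: "('p, 'b, 'n) smc_data_scheme"
    and F G :: "('o, 'a, 'p, 'b) frob_functor_data" +
  fixes \<sigma> :: "'o \<Rightarrow> 'b"
  assumes transf: "frobenius_transformation C D F G \<sigma>"
begin

lemma transf_in: "x \<in> Obj C \<Longrightarrow> \<sigma> x \<in> Hom D (FObj F x) (FObj G x)"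
  using transf by (simp add: frobenius_transformation_def nat_transformation_def)

lemma transf_in_Arr: "x \<in> Obj C \<Longrightarrow> \<sigma> x \<in> Arr D"
  by (rule F.D.HomD(1)[OF transf_in])

lemma transf_ext: "\<sigma> \<in> extensional (Obj C)"
  using transf by (simp add: frobenius_transformation_def nat_transformation_def)

lemma tensor_transf_in: "X \<in> lists (Obj C) \<Longrightarrow>
    tensor_arrs D \<sigma> X \<in> Hom D (tensor_objs D (FObj F) X) (tensor_objs D (FObj G) X)"
  by (rule F.D.tensor_arrs_in) (auto intro: transf_in)

lemma tensor_transf_append: "X \<in> lists (Obj C) \<Longrightarrow> Y \<in> lists (Obj C) \<Longrightarrow>
    tensor_arrs D \<sigma> (X @ Y) = tensor_arrs D \<sigma> X \<otimes>\<^bsub>D\<^esub> tensor_arrs D \<sigma> Y"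
  by (rule F.D.tensor_arrs_append) (auto intro: transf_in_Arr)

text \<open>Naturality is proved on terms, so no relation is consulted: generators are covered by
  the axioms on \<sigma>, composites by pasting squares, tensor products by interchange.\<close>

lemma tensor_transf_natural:
  "fwf C t \<Longrightarrow>
    tensor_arrs D \<sigma> (fcod C t) \<cdot>\<^bsub>D\<^esub> eval_fterm D F t = eval_fterm D G t \<cdot>\<^bsub>D\<^esub> tensor_arrs D \<sigma> (fdom C t)"
proof (induction t)
  case (FId X)
  then show ?case
    using F.D.Comp_Id_left[OF tensor_transf_in] F.D.Comp_Id_right[OF tensor_transf_in] by simp
next
  case (FGen f)
  then have f: "f \<in> Hom C (Dom C f) (Cod C f)"
    by (simp add: F.C.Arr_Hom)
  from FGen have "\<sigma> (Cod C f) \<cdot>\<^bsub>D\<^esub> FArr F f = FArr G f \<cdot>\<^bsub>D\<^esub> \<sigma> (Dom C f)"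
    using transf f
    by (simp add: frobenius_transformation_def nat_transformation_def F.C.Dom_in F.C.Cod_in)
  with FGen show ?case
    by (simp add: F.D.Tensor_Unit_right transf_in_Arr F.C.Dom_in F.C.Cod_in)
next
  case (FComp t s)
  then have "fwf C t" "fwf C s" "fdom C t = fcod C s" by auto
  then show ?case
    using F.D.Comp_square[OF F.eval_fterm_in[of s] F.eval_fterm_in_Hom[of t]
        G.eval_fterm_in[of s] G.eval_fterm_in_Hom[of t] tensor_transf_in tensor_transf_in tensor_transf_in]
      FComp.IH F.C.fdom_fcod_in[of t] F.C.fdom_fcod_in[of s]
    by simp
next
  case (FTen t s)
  then have wf: "fwf C t" "fwf C s" by auto
  note lists = F.C.fdom_fcod_in[OF wf(1)] F.C.fdom_fcod_in[OF wf(2)]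
  from FTen wf show ?case
    \<comment> \<open>Each side of the square for the tensor term is a tensor product of the
      corresponding sides for \<open>t\<close> and \<open>s\<close>; one pair of interchange
      instances is needed per side.\<close>
    using F.D.interchange[OF F.eval_fterm_in[OF wf(1)] tensor_transf_in
        F.eval_fterm_in[OF wf(2)] tensor_transf_in]
      F.D.interchange[OF tensor_transf_in G.eval_fterm_in[OF wf(1)]
        tensor_transf_in G.eval_fterm_in[OF wf(2)]]
    by (simp add: tensor_transf_append lists del: in_lists_conv_set)
\<comment> \<open>The component at the empty list is an identity, which reduces the squares at
  \<open>FJ\<close> and \<open>FQ\<close> to the unit and counit conditions.\<close>
qed (use transf in \<open>auto simp: frobenius_transformation_def F.D.Tensor_Unit_right transf_in_Arr
    F.C.TensorO_in F.C.Unit_in F.D.Comp_Id_left[OF F.counit_in] F.D.Comp_Id_right[OF G.unit_in]\<close>)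

lemma monoidal_transformation_extend:
  "monoidal_transformation (Frobenius_classifier C) D (extend_functor C D F) (extend_functor C D G)
    (extend_transformation C D \<sigma>)"
proof -
  have "nat_transformation (Frobenius_classifier C) D (extend_functor C D F) (extend_functor C D G)
      (extend_transformation C D \<sigma>)"
    unfolding nat_transformation_def
    using tensor_transf_in F.C.fdom_fcod_in
    by (auto simp: extend_transformation_def F.C.FC_simps F.C.FC_Hom F.extend_functor_simps
        G.extend_functor_simps tensor_transf_natural)
  then show ?thesis
    by (auto simp: monoidal_transformation_def extend_transformation_def F.C.FC_simps
        tensor_transf_append simp del: in_lists_conv_set)
qed

lemma restrict_extend_transformation:
  "restrict_transformation C (extend_transformation C D \<sigma>) = \<sigma>"
  using extensional_arb[OF transf_ext]
  by (auto simp: fun_eq_iff restrict_transformation_def extend_transformation_def restrict_def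
      F.D.Tensor_Unit_right transf_in_Arr)

end

locale classifier_transf = F: classifier_functor C D F + G: classifier_functor C D G
  for C :: "('o, 'a, 'm) smc_data_scheme"
    and D :: "('p, 'b, 'n) smc_data_scheme"
    and F G :: "('o list, ('o, 'a) fterm set, 'p, 'b) functor_data" +
  fixes \<tau> :: "'o list \<Rightarrow> 'b"
  assumes transf: "monoidal_transformation (Frobenius_classifier C) D F G \<tau>"
begin

lemma transf_in: "X \<in> lists (Obj C) \<Longrightarrow> \<tau> X \<in> Hom D (FObj F X) (FObj G X)"
  using transf by (simp add: monoidal_transformation_def nat_transformation_def F.C.FC_simps)

lemma transf_ext: "\<tau> \<in> extensional (lists (Obj C))"
  using transf by (simp add: monoidal_transformation_def nat_transformation_def F.C.FC_simps)

lemma transf_Nil: "\<tau> [] = Iden D \<one>\<^bsub>D\<^esub>"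
  using transf by (simp add: monoidal_transformation_def F.C.FC_simps)

lemma transf_append: "X \<in> lists (Obj C) \<Longrightarrow> Y \<in> lists (Obj C) \<Longrightarrow> \<tau> (X @ Y) = \<tau> X \<otimes>\<^bsub>D\<^esub> \<tau> Y"
  using transf by (simp add: monoidal_transformation_def F.C.FC_simps del: in_lists_conv_set)

lemma transf_pair: "x \<in> Obj C \<Longrightarrow> y \<in> Obj C \<Longrightarrow> \<tau> [x, y] = \<tau> [x] \<otimes>\<^bsub>D\<^esub> \<tau> [y]"
  using transf_append[of "[x]" "[y]"] by simp

lemma transf_natural:
  assumes "fwf C t"
  shows "\<tau> (fcod C t) \<cdot>\<^bsub>D\<^esub> FArr F (fclass C t) = FArr G (fclass C t) \<cdot>\<^bsub>D\<^esub> \<tau> (fdom C t)"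
proof -
  have "fclass C t \<in> Hom (Frobenius_classifier C) (fdom C t) (fcod C t)"
    using assms by (auto simp: F.C.FC_Hom)
  then show ?thesis
    using transf F.C.fdom_fcod_in[OF assms]
    by (simp add: monoidal_transformation_def nat_transformation_def F.C.FC_simps
        del: in_lists_conv_set)
qed

lemma frobenius_transformation_restrict:
  "frobenius_transformation C D (restrict_functor C F) (restrict_functor C G)
    (restrict_transformation C \<tau>)"
proof -
  have "nat_transformation C D (restrict_functor C F) (restrict_functor C G)
      (restrict_transformation C \<tau>)"
    unfolding nat_transformation_def
    using transf_natural[of "FGen _"]
    by (auto simp: restrict_transformation_def F.restrict_functor_simps G.restrict_functor_simps
        transf_in Hom_def[of C])
  \<comment> \<open>Here, as for the counit below, one edge of the naturality square is
    \<open>\<tau> []\<close>, an identity, so the square collapses to a triangle.\<close>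
  moreover have "\<tau> [\<one>\<^bsub>C\<^esub>] \<cdot>\<^bsub>D\<^esub> FArr F (fclass C FJ) = FArr G (fclass C FJ)"
    using transf_natural[of FJ] F.D.Comp_Id_right[OF G.FArr_fclass_in[of FJ]]
    by (simp add: transf_Nil G.FObj_Nil)
  moreover have "FArr G (fclass C FQ) \<cdot>\<^bsub>D\<^esub> \<tau> [\<one>\<^bsub>C\<^esub>] = FArr F (fclass C FQ)"
    using transf_natural[of FQ] F.D.Comp_Id_left[OF F.FArr_fclass_in[of FQ]]
    by (simp add: transf_Nil F.FObj_Nil)
  ultimately show ?thesis
    using transf_natural[of "FL _ _"] transf_natural[of "FK _ _"]
    by (simp add: frobenius_transformation_def restrict_transformation_def F.C.TensorO_in F.C.Unit_in
        F.restrict_functor_simps G.restrict_functor_simps transf_pair)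
qed

text \<open>Monoidality splits off one letter at a time, forcing the component at a list to be the
  tensor product of the components at its letters.\<close>

lemma extend_restrict_transformation:
  "extend_transformation C D (restrict_transformation C \<tau>) = \<tau>"
proof
  fix X
  have "X \<in> lists (Obj C) \<Longrightarrow> tensor_arrs D (restrict_transformation C \<tau>) X = \<tau> X"
  proof (induction X)
    case (Cons x X)
    then show ?case
      using transf_append[of "[x]" X] by (simp add: restrict_transformation_def)
  qed (simp add: transf_Nil)
  then show "extend_transformation C D (restrict_transformation C \<tau>) X = \<tau> X"
    using extensional_arb[OF transf_ext, of X]
    by (auto simp: extend_transformation_def restrict_def)
qed

end

section \<open>Functoriality of extension on transformations\<close>

lemma (in frobenius_functor) extend_transformation_Iden:
  "extend_transformation C D (\<lambda>x\<in>Obj C. Iden D (FObj F x)) =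
    (\<lambda>X\<in>Obj (Frobenius_classifier C). Iden D (FObj (extend_functor C D F) X))"
proof -
  have "tensor_arrs D (\<lambda>x\<in>Obj C. Iden D (FObj F x)) X = Iden D (tensor_objs D (FObj F) X)"
    if "X \<in> lists (Obj C)" for X
  proof -
    have "tensor_arrs D (\<lambda>x\<in>Obj C. Iden D (FObj F x)) X = tensor_arrs D (\<lambda>x. Iden D (FObj F x)) X"
      using that by (intro tensor_arrs_cong) auto
    also have "\<dots> = Iden D (tensor_objs D (FObj F) X)"
      using that by (intro D.tensor_arrs_Iden) (auto intro: FObj_in_Obj)
    finally show ?thesis .
  qed
  then show ?thesis
    by (auto simp: extend_transformation_def C.FC_simps extend_functor_simps fun_eq_iff restrict_def)
qed

lemma extend_transformation_Comp:
  assumes "frobenius_transf C D F G \<sigma>" "frobenius_transf C D G H \<tau>"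
  shows "extend_transformation C D (\<lambda>x\<in>Obj C. \<tau> x \<cdot>\<^bsub>D\<^esub> \<sigma> x) =
    (\<lambda>X\<in>Obj (Frobenius_classifier C).
      extend_transformation C D \<tau> X \<cdot>\<^bsub>D\<^esub> extend_transformation C D \<sigma> X)"
proof -
  interpret \<sigma>: frobenius_transf C D F G \<sigma> by fact
  interpret \<tau>: frobenius_transf C D G H \<tau> by fact
  have "tensor_arrs D (\<lambda>x\<in>Obj C. \<tau> x \<cdot>\<^bsub>D\<^esub> \<sigma> x) X = tensor_arrs D \<tau> X \<cdot>\<^bsub>D\<^esub> tensor_arrs D \<sigma> X"
    if "X \<in> lists (Obj C)" for X
  proof -
    have "tensor_arrs D (\<lambda>x\<in>Obj C. \<tau> x \<cdot>\<^bsub>D\<^esub> \<sigma> x) X = tensor_arrs D (\<lambda>x. \<tau> x \<cdot>\<^bsub>D\<^esub> \<sigma> x) X"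
      using that by (intro tensor_arrs_cong) auto
    also have "\<dots> = tensor_arrs D \<tau> X \<cdot>\<^bsub>D\<^esub> tensor_arrs D \<sigma> X"
      using that by (intro \<sigma>.F.D.tensor_arrs_Comp) (auto intro: \<sigma>.transf_in \<tau>.transf_in)
    finally show ?thesis .
  qed
  then show ?thesis
    by (auto simp: extend_transformation_def \<sigma>.F.C.FC_simps fun_eq_iff restrict_def)
qed

section \<open>Assembling the isomorphism of categories\<close>

lemma Frob_simps:
  "Obj (Frob C D) = {F. frobenius_functor C D F}"
  "Arr (Frob C D) = {(F, G, \<sigma>). frobenius_transf C D F G \<sigma>}"
  "Dom (Frob C D) (F, G, \<sigma>) = F"
  "Cod (Frob C D) (F, G, \<sigma>) = G"
  "Iden (Frob C D) F = (F, F, \<lambda>x\<in>Obj C. Iden D (FObj F x))"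
  "(G', H, \<tau>) \<cdot>\<^bsub>Frob C D\<^esub> (F, G, \<sigma>) = (F, H, \<lambda>x\<in>Obj C. \<tau> x \<cdot>\<^bsub>D\<^esub> \<sigma> x)"
  by (auto simp: Frob_def transformation_category_def frobenius_transf_def frobenius_transf_axioms_def)

lemma Strict_simps:
  "Obj (Strict C D) = {F. strict_monoidal_functor C D F}"
  "Arr (Strict C D) =
    {(F, G, \<sigma>). strict_monoidal_functor C D F \<and> strict_monoidal_functor C D G \<and>
      monoidal_transformation C D F G \<sigma>}"
  "Dom (Strict C D) (F, G, \<sigma>) = F"
  "Cod (Strict C D) (F, G, \<sigma>) = G"
  "Iden (Strict C D) F = (F, F, \<lambda>x\<in>Obj C. Iden D (FObj F x))"
  "(G', H, \<tau>) \<cdot>\<^bsub>Strict C D\<^esub> (F, G, \<sigma>) = (F, H, \<lambda>x\<in>Obj C. \<tau> x \<cdot>\<^bsub>D\<^esub> \<sigma> x)"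
  by (auto simp: Strict_def transformation_category_def)

theorem theorem2p7:
  fixes C :: "('o, 'a) smc_data" and D :: "('p, 'b) smc_data"
  assumes "strict_monoidal_category C" and "strict_monoidal_category D"
  shows "isomorphic_categories (Frob C D) (Strict (Frobenius_classifier C) D)"
proof -
  let ?FC = "Frobenius_classifier C"
  have classifier: "classifier_functor C D G" if "strict_monoidal_functor ?FC D G" for G
    using assms that by (simp add: classifier_functor_def)
  have classifier_transf: "classifier_transf C D F G \<tau>"
    if "strict_monoidal_functor ?FC D F" "strict_monoidal_functor ?FC D G"
      "monoidal_transformation ?FC D F G \<tau>" for F G \<tau>
    using that by (simp add: classifier_transf_def classifier_transf_axioms_def classifier)
  have frobenius: "frobenius_functor C D F" "frobenius_functor C D G"
    if "frobenius_transf C D F G \<sigma>" for F G \<sigma>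
    using that by (auto simp: frobenius_transf_def)
  have restrict: "frobenius_transf C D (restrict_functor C F) (restrict_functor C G)
      (restrict_transformation C \<tau>)"
    if "strict_monoidal_functor ?FC D F" "strict_monoidal_functor ?FC D G"
      "monoidal_transformation ?FC D F G \<tau>" for F G \<tau>
    using classifier_transf.frobenius_transformation_restrict[OF classifier_transf[OF that]] that
    by (simp add: frobenius_transf_def frobenius_transf_axioms_def classifier
        classifier_functor.frobenius_functor_restrict_functor)
  show ?thesis
  \<comment> \<open>Extension is taken as the forward direction, so identities and composites have
    to be checked for it alone; restriction only has to be well typed and inverse to it.\<close>
  proof (rule isomorphic_categoriesI[where \<phi> = "extend_functor C D" and \<psi> = "restrict_functor C"
        and \<alpha> = "\<lambda>(F, G, \<sigma>). (extend_functor C D F, extend_functor C D G, extend_transformation C D \<sigma>)"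
        and \<beta> = "\<lambda>(F, G, \<tau>). (restrict_functor C F, restrict_functor C G, restrict_transformation C \<tau>)"])
    show "category (Frob C D)" "category (Strict ?FC D)"
      by (rule category_Frob category_Strict)+
  qed (auto simp: Frob_simps Strict_simps Hom_def[of "Frob C D"] Hom_def[of "Strict ?FC D"]
      frobenius classifier restrict
      frobenius_functor.strict_monoidal_functor_extend_functor
      frobenius_functor.restrict_extend_functor
      classifier_functor.frobenius_functor_restrict_functor
      classifier_functor.extend_restrict_functor
      frobenius_transf.monoidal_transformation_extend
      frobenius_transf.restrict_extend_transformation
      classifier_transf.extend_restrict_transformation[OF classifier_transf]
      frobenius_functor.extend_transformation_Iden extend_transformation_Comp)
qed

end
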